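(* Let $(P)$ be the problem in the context. Suppose that Assumption (D) (bounded domains), Assumption (S) (structure) and the constraint qualification $\mathbf{CQ}$ from the context hold. Let $(x^*,y^* )$ be a solution to $(P)$ and let $\bar\lambda\in\mathcal{E}$ satisfy $0\in\partial f(x^* )+A^*\bar\lambda$ and $0\in\partial g(y^* )+B^*\bar\lambda$. Let $\{(x^t,y^t)\}$ be generated by the algorithm in the context. Then for all $t\ge 2$, $$\left|f(x^t)+g(y^t)-f(x^* )-g(y^* )\right|\le\max\{\tau_t,\ \|\bar\lambda\|\cdot\mathcal{G}_t\},\qquad \|Ax^t+By^t-c\|\le\mathcal{G}_t,$$ where $$\tau_t=\begin{cases}\dfrac{\omega_1}{t(t+1)}+\dfrac{\omega_2}{(t+1)^{1-\delta}}+\dfrac{\omega_3}{(t+1)^{\nu}}+\dfrac{\omega_4}{(t+1)^{\mu}}&\text{if }\mu\in(0,1),\\[2mm] \dfrac{\omega_1}{t(t+1)}+\dfrac{\omega_2}{(t+1)^{1-\delta}}+\dfrac{\omega_3}{(t+1)^{\nu}}+\dfrac{\omega_5}{t+1}&\text{if }\mu=1,\end{cases}$$ $$\mathcal{G}_t=\frac{\|\bar\lambda\|}{\beta_0t^{\delta}}+\sqrt{\frac{\|\bar\lambda\|^2}{\beta_0^2t^{2\delta}}+\frac{2\tau_t}{\beta_0t^{\delta}}},$$ with $$\omega_1=2^{\delta+3}\beta_0D_2+\vartheta,\quad \omega_2=2\lambda_AD_f^2\beta_0+2\lambda_BD_g^2\beta_0+\frac{32+16\delta}{1+\delta}D_2\beta_0,\quad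 \omega_3=\frac{2^{\nu+1}}{\nu+1}M_gD_g^{\nu+1},$$ $$\omega_4=2\widetilde H_0D_f^2+2\omega_0,\quad \omega_5=2\widetilde H_0D_f^2,\quad \omega_0=4\widetilde H_0\left(\frac{2M_f}{(1+\mu)\widetilde H_0}\right)^{\frac{2}{1-\mu}},\quad \widetilde H_0=\max\left\{H_0,\frac{2M_f}{\mu+1}\right\},$$ $$\vartheta=2\left(f(x^1)+g(y^1)+\frac{\beta_0}{2}\|Ax^1+By^1-c\|^2-f(x^* )-g(y^* )\right),$$ $\lambda_A=\lambda_{\max}(A^*A)$, $\lambda_B=\lambda_{\max}(B^*B)$ and $D_2=\sup_{x\in\operatorname{dom}f,\,y\in\operatorname{dom}g}|\langle Ax,By\rangle|<\infty$ (the constants $\omega_0,\omega_4$ are used only when $\mu\in(0,1)$).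
   Context: Problem $(P)$: $\min_{x\in\mathcal{E}_1,y\in\mathcal{E}_2} f(x)+g(y)$ subject to $Ax+By=c$, where $\mathcal{E},\mathcal{E}_1,\mathcal{E}_2$ are finite dimensional (real) Hilbert spaces, $c\in\mathcal{E}$, $A:\mathcal{E}_1\to\mathcal{E}$ and $B:\mathcal{E}_2\to\mathcal{E}$ are linear, $f:\mathcal{E}_1\to(-\infty,\infty]$ and $g:\mathcal{E}_2\to(-\infty,\infty]$ are proper closed convex, and the solution set is nonempty. $A^*$ is the adjoint, $\lambda_{\max}$ the largest eigenvalue, $\partial$ the convex subdifferential, $\operatorname{dom}$ the effective domain, $\mathrm{ri}$ the relative interior. $\mathbf{CQ}$: $c\in A\,\mathrm{ri}(\operatorname{dom}f)+B\,\mathrm{ri}(\operatorname{dom}g)$. Assumption (D): $D_f:=\sup_{x_1,x_2\in\operatorname{dom}f}\|x_1-x_2\|<\infty$ and $D_g:=\sup_{y_1,y_2\in\operatorname{dom}g}\|y_1-y_2\|<\infty$. Assumption (S): $f=f_1+f_2$, $g=g_1+g_2$ with $f_1:\mathcal{E}_1\to\mathbb{R}$, $g_1:\mathcal{E}_2\to\mathbb{R}$ convex and smooth, $f_2:\mathcal{E}_1\to(-\infty,\infty]$, $g_2:\mathcal{E}_2\to(-\infty,\infty]$ proper closed convex; $\nabla f_1$ and $\nabla g_1$ are Hölder continuous on $\operatorname{dom}f$ and $\operatorname{dom}g$ respectively, and $\mu,\nu\in(0,1]$, $M_f,M_g\ge0$ are constants such that $f_1(y)\le f_1(x)+\langle\nabla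 f_1(x),y-x\rangle+\frac{M_f}{\mu+1}\|y-x\|^{\mu+1}$ for all $x,y\in\operatorname{dom}f$, and $g_1(y)\le g_1(x)+\langle\nabla g_1(x),y-x\rangle+\frac{M_g}{\nu+1}\|y-x\|^{\nu+1}$ for all $x,y\in\operatorname{dom}g$; and for every $v\in\mathcal{E}_2$ a minimizer of $y\mapsto\langle v,y\rangle+g_2(y)$ over $\mathcal{E}_2$ exists. (The paper also assumes that these minimizers and the proximal mappings of $\gamma f_2$, $\gamma>0$, can be computed efficiently.) Algorithm: choose $x^0\in\operatorname{dom}f$, $y^0\in\operatorname{dom}g$, $\beta_0>0$, $H_0>0$, $\delta\in(0,1)$; let $\lambda_A=\lambda_{\max}(A^*A)$. For $t=0,1,\dots$, with $\alpha_t=\frac{2}{t+2}$: $R^t=Ax^t+By^t-c$; $x^{t+1}=\arg\min_{x}\ \langle\nabla f_1(x^t)+\beta_tA^*R^t,x-x^t\rangle+\frac{H_t+\lambda_A\beta_t}{2}\|x-x^t\|^2+f_2(x)$; $\widetilde R^t=Ax^{t+1}+By^t-c$; $u^t\in\operatorname{Argmin}_{y}\ \langle\nabla g_1(y^t)+\beta_tB^*\widetilde R^t,y\rangle+g_2(y)$ (any minimizer); $y^{t+1}=y^t+\alpha_t(u^t-y^t)$; $H_{t+1}=\max\{H_0,\frac{2M_f}{\mu+1}\}(t+1)^{1-\mu}$, $\beta_{t+1}=\beta_0(t+2)^{\delta}$ (so $\beta_t=\beta_0(t+1)^\delta$ for all $t\ge0$). *)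

theory Defs
  imports "HOL-Analysis.Analysis"
begin

(* A map into (-infinity, infinity] is an ereal-valued function that never takes the
   value -infinity; the latter requirement is part of proper_closed_convex. *)

definition eff_dom :: "('a \<Rightarrow> ereal) \<Rightarrow> 'a set" where
  "eff_dom f = {x. f x < \<infinity>}"

(* The library's epigraph is for real-valued functions only. *)
definition ereal_epigraph :: "('a \<Rightarrow> ereal) \<Rightarrow> ('a \<times> real) set" where
  "ereal_epigraph f = {(x, r). f x \<le> ereal r}"

definition proper_closed_convex :: "('a::euclidean_space \<Rightarrow> ereal) \<Rightarrow> bool" where
  "proper_closed_convex f \<longleftrightarrow>
     (\<forall>x. f x \<noteq> -\<infinity>) \<and> (\<exists>x. f x \<noteq> \<infinity>) \<and>
     closed (ereal_epigraph f) \<and> convex (ereal_epigraph f)"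

(* For proper f this set is empty when f x = \<infinity>, in line with the usual convention. *)
definition subdifferential :: "('a::real_inner \<Rightarrow> ereal) \<Rightarrow> 'a \<Rightarrow> 'a set" where
  "subdifferential f x = {v. \<forall>y. f x + ereal (v \<bullet> (y - x)) \<le> f y}"

definition lambda_max :: "('a::real_vector \<Rightarrow> 'a) \<Rightarrow> real" where
  "lambda_max T = (GREATEST l. \<exists>v. v \<noteq> 0 \<and> T v = l *\<^sub>R v)"

(* Convex and continuously differentiable on the whole space, with gradient G. *)
definition smooth_convex_with_gradient ::
    "('a::euclidean_space \<Rightarrow> real) \<Rightarrow> ('a \<Rightarrow> 'a) \<Rightarrow> bool" where
  "smooth_convex_with_gradient h G \<longleftrightarrow>
     convex_on UNIV h \<and> (\<forall>x. GDERIV h x :> G x) \<and> continuous_on UNIV G"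

definition hoelder_continuous_on ::
    "'a set \<Rightarrow> ('a::real_normed_vector \<Rightarrow> 'b::real_normed_vector) \<Rightarrow> bool" where
  "hoelder_continuous_on S G \<longleftrightarrow>
     (\<exists>p L. 0 < p \<and> p \<le> 1 \<and> 0 \<le> L \<and>
        (\<forall>x\<in>S. \<forall>y\<in>S. norm (G x - G y) \<le> L * norm (x - y) powr p))"

(* (xs, ys) minimizes f x + g y subject to A x + B y = c. *)
definition solves_P ::
    "('a \<Rightarrow> ereal) \<Rightarrow> ('b \<Rightarrow> ereal) \<Rightarrow> ('a \<Rightarrow> 'e::plus) \<Rightarrow> ('b \<Rightarrow> 'e) \<Rightarrow> 'e \<Rightarrow> 'a \<Rightarrow> 'b \<Rightarrow> bool" where
  "solves_P f g A B c xs ys \<longleftrightarrow>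
     A xs + B ys = c \<and> (\<forall>x y. A x + B y = c \<longrightarrow> f xs + g ys \<le> f x + g y)"

end

theory Submission
  imports Defs
begin

text \<open>
  Put \<open>P\<^sub>t = f(x\<^sup>t) + g(y\<^sup>t) - f(x\<^sup>*) - g(y\<^sup>*) + \<beta>\<^sub>t\<^sub>-\<^sub>1/2 \<parallel>Ax\<^sup>t + By\<^sup>t - c\<parallel>\<^sup>2\<close>. Comparing the proximal step with
  \<open>x\<^sup>t + \<alpha>\<^sub>t (x\<^sup>* - x\<^sup>t)\<close> and the linear minimization step with \<open>y\<^sup>*\<close> gives
  \<open>P\<^sub>t\<^sub>+\<^sub>1 \<le> (1 - \<alpha>\<^sub>t) P\<^sub>t + \<alpha>\<^sub>t \<beta>\<^sub>t \<langle>A(x\<^sup>t\<^sup>+\<^sup>1 - x\<^sup>t), B(y\<^sup>* - y\<^sup>t)\<rangle> + E\<^sub>t\<close> for \<open>t \<ge> 1\<close>. After multiplication by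
  \<open>(t + 1)(t + 2)\<close> the recursion telescopes. The inner products enter only to first order in \<open>\<alpha>\<^sub>t\<close>, but
  summation by parts moves the difference from \<open>x\<close> to \<open>y\<close>, whose increments \<open>\<alpha>\<^sub>t (u\<^sup>t - y\<^sup>t)\<close> supply
  the missing factor. Hence \<open>P\<^sub>t \<le> \<tau>\<^sub>t\<close>. The multiplier bounds the objective gap below by
  \<open>- \<parallel>\<lambda>\<parallel> \<parallel>Ax\<^sup>t + By\<^sup>t - c\<parallel>\<close>, so the residual satisfies a quadratic inequality with larger root \<open>G\<^sub>t\<close>.
\<close>

section \<open>The largest eigenvalue of \<open>adjoint A \<circ> A\<close> as a Rayleigh
  maximum\<close>

lemma quadratic_nonpos_imp_linear_zero:
  fixes a b :: real
  assumes "\<And>t. 2 * t * a + t\<^sup>2 * b \<le> 0"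
  shows "a = 0"
proof (rule ccontr)
  assume "a \<noteq> 0"
  \<comment> \<open>The step \<open>a / k\<close> is so short that the linear term wins: the
    quadratic takes the value \<open>(a / k)\<^sup>2 * (2 * k + b)\<close> there, which is positive
    because \<open>b > - k\<close>.\<close>
  define k where "k = \<bar>b\<bar> + 1"
  have k: "k > 0" "b > - k" by (auto simp: k_def)
  have "2 * (a / k) * a + (a / k)\<^sup>2 * b = (a / k)\<^sup>2 * (2 * k + b)"
    using k by (simp add: field_simps power2_eq_square)
  moreover have "(a / k)\<^sup>2 * (2 * k + b) > 0"
    using k \<open>a \<noteq> 0\<close> by (intro mult_pos_pos) auto
  ultimately show False using assms[of "a / k"] by linarith
qed

lemma power2_norm_add_scaleR:
  fixes p q :: "'a::real_inner"
  shows "(norm (p + t *\<^sub>R q))\<^sup>2 = (norm p)\<^sup>2 + 2 * t * (p \<bullet> q) + t\<^sup>2 * (norm q)\<^sup>2"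
  unfolding power2_norm_eq_inner
  by (simp add: inner_add_left inner_add_right inner_commute power2_eq_square algebra_simps)

text \<open>By compactness the Rayleigh quotient attains its maximum \<open>m\<close> on the unit
  sphere, and the first-order condition at a maximizer makes it an eigenvector for \<open>m\<close>.
  Any eigenvalue is itself a value of the quotient, so \<open>m\<close> is the greatest one and
  \<open>GREATEST\<close> is attained.\<close>

lemma lambda_max_adjoint_self:
  fixes A :: "'a::euclidean_space \<Rightarrow> 'e::euclidean_space"
  assumes A: "linear A"
  shows "(norm (A x))\<^sup>2 \<le> lambda_max (adjoint A \<circ> A) * (norm x)\<^sup>2"
proof -
  interpret A: linear A by (rule A)
  have adj: "adjoint A u \<bullet> w = u \<bullet> A w" for u w
    using adjoint_works[OF A, of w u] by (simp add: inner_commute)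
  have "continuous_on (sphere 0 1) (\<lambda>z. (norm (A z))\<^sup>2)"
    using A by (intro continuous_intros linear_continuous_on) (simp add: linear_conv_bounded_linear)
  moreover have "sphere (0::'a) 1 \<noteq> {}" by simp
  ultimately obtain v where v: "norm v = 1" and
    max: "\<And>z. norm z = 1 \<Longrightarrow> (norm (A z))\<^sup>2 \<le> (norm (A v))\<^sup>2"
    using continuous_attains_sup[OF compact_sphere, of 0 1 "\<lambda>z. (norm (A z))\<^sup>2"]
    by (auto simp: dist_norm)
  define m where "m = (norm (A v))\<^sup>2"
  have le: "(norm (A z))\<^sup>2 \<le> m * (norm z)\<^sup>2" for z
  proof (cases "z = 0")
    case False
    have "(norm (A ((1 / norm z) *\<^sub>R z)))\<^sup>2 \<le> m"
      unfolding m_def by (rule max) (use False in simp)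
    then show ?thesis
      using False by (simp add: A.scaleR power_mult_distrib power_divide field_simps)
  qed (simp add: A.zero)
  \<comment> \<open>The function \<open>(norm (A z))\<^sup>2 - m * (norm z)\<^sup>2\<close> is
    nowhere positive and vanishes at \<open>v\<close>. Along \<open>v + t *\<^sub>R w\<close> it is
    therefore a quadratic in \<open>t\<close> without constant term, whose linear coefficient must
    be zero.\<close>
  have "A v \<bullet> A w - m * (v \<bullet> w) = 0" for w
  proof (rule quadratic_nonpos_imp_linear_zero)
    fix t :: real
    have "(norm (A (v + t *\<^sub>R w)))\<^sup>2 - m * (norm (v + t *\<^sub>R w))\<^sup>2 \<le> 0"
      using le by simp
    then show "2 * t * (A v \<bullet> A w - m * (v \<bullet> w))
        + t\<^sup>2 * ((norm (A w))\<^sup>2 - m * (norm w)\<^sup>2) \<le> 0"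
      using v m_def by (simp add: A.add A.scaleR power2_norm_add_scaleR algebra_simps)
  qed
  then have "(adjoint A (A v) - m *\<^sub>R v) \<bullet> w = 0" for w
    by (simp add: inner_diff_left adj)
  then have "adjoint A (A v) = m *\<^sub>R v"
    by (metis inner_eq_zero_iff right_minus_eq)
  then have eig: "\<exists>v. v \<noteq> 0 \<and> (adjoint A \<circ> A) v = m *\<^sub>R v"
    using v by (intro exI[of _ v]) auto
  have "lambda_max (adjoint A \<circ> A) = m"
    unfolding lambda_max_def
  proof (rule Greatest_equality)
    show "\<exists>v. v \<noteq> 0 \<and> (adjoint A \<circ> A) v = m *\<^sub>R v" by (rule eig)
  next
    fix l
    assume "\<exists>v. v \<noteq> 0 \<and> (adjoint A \<circ> A) v = l *\<^sub>R v"
    then obtain z where z: "z \<noteq> 0" "adjoint A (A z) = l *\<^sub>R z" by auto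
    have "l * (norm z)\<^sup>2 = (norm (A z))\<^sup>2"
      using adj[of "A z" z] z by (simp add: power2_norm_eq_inner)
    then have "l * (norm z)\<^sup>2 \<le> m * (norm z)\<^sup>2" using le by simp
    then show "l \<le> m" using z by simp
  qed
  with le show ?thesis by simp
qed

lemma lambda_max_adjoint_self_nonneg:
  fixes A :: "'a::euclidean_space \<Rightarrow> 'e::euclidean_space"
  assumes "linear A"
  shows "0 \<le> lambda_max (adjoint A \<circ> A)"
proof -
  obtain b :: 'a where "b \<in> Basis" using nonempty_Basis by blast
  then show ?thesis
    using order_trans[OF zero_le_power2 lambda_max_adjoint_self[OF assms, of b]] by simp
qed

section \<open>Tangents, and passage from extended-real to real convexity\<close>

lemma smooth_convex_above_tangent:
  assumes "smooth_convex_with_gradient h G"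
  shows "h z + G z \<bullet> (w - z) \<le> h w"
proof -
  have cvx: "convex_on UNIV h" and der: "(h has_derivative (\<lambda>d. G z \<bullet> d)) (at z)"
    using assms by (auto simp: smooth_convex_with_gradient_def gderiv_def inner_commute)
  \<comment> \<open>Restriction to the line through \<open>z\<close> and \<open>w\<close> reduces
    the claim to the tangent inequality in one variable, with slope
    \<open>G z \<bullet> (w - z)\<close> at 0.\<close>
  define p where "p t = h (z + t *\<^sub>R (w - z))" for t :: real
  have "convex_on UNIV p"
  proof (rule convex_onI)
    fix t s r :: real
    assume t: "0 < t" "t < 1"
    have "z + ((1 - t) * s + t * r) *\<^sub>R (w - z)
        = (1 - t) *\<^sub>R (z + s *\<^sub>R (w - z)) + t *\<^sub>R (z + r *\<^sub>R (w - z))"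
      by (simp add: algebra_simps)
    then show "p ((1 - t) *\<^sub>R s + t *\<^sub>R r) \<le> (1 - t) * p s + t * p r"
      using convex_onD[OF cvx, of t "z + s *\<^sub>R (w - z)" "z + r *\<^sub>R (w - z)"] t
      by (simp add: p_def)
  qed simp
  moreover have "(p has_real_derivative G z \<bullet> (w - z)) (at 0 within UNIV)"
    unfolding p_def has_field_derivative_def
    by (rule has_derivative_eq_rhs, rule has_derivative_compose[of _ _ 0 UNIV h "\<lambda>d. G z \<bullet> d"])
       (auto intro!: derivative_eq_intros der simp: der fun_eq_iff)
  ultimately have "p 1 - p 0 \<ge> G z \<bullet> (w - z) * (1 - 0)"
    by (intro convex_on_imp_above_tangent[of UNIV]) auto
  then show ?thesis by (simp add: p_def)
qed

lemma proper_closed_convex_finite: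
  assumes "proper_closed_convex h" "z \<in> eff_dom h"
  shows "h z = ereal (real_of_ereal (h z))"
  using assms by (cases "h z") (auto simp: proper_closed_convex_def eff_dom_def)

text \<open>At points of finite value the graph lies in the convex epigraph, and so do its chords.
  This lets all later estimates run in the reals.\<close>

lemma proper_closed_convex_convex_on:
  fixes h :: "'a::euclidean_space \<Rightarrow> ereal"
  assumes h: "proper_closed_convex h"
  shows "convex_on (eff_dom h) (\<lambda>z. real_of_ereal (h z))"
proof -
  have seg: "h ((1 - t) *\<^sub>R z + t *\<^sub>R w)
      \<le> ereal ((1 - t) * real_of_ereal (h z) + t * real_of_ereal (h w))"
    if "0 \<le> t" "t \<le> 1" "z \<in> eff_dom h" "w \<in> eff_dom h" for t z w
  proof -
    have "(z, real_of_ereal (h z)) \<in> ereal_epigraph h" "(w, real_of_ereal (h w)) \<in> ereal_epigraph h"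
      using proper_closed_convex_finite[OF h] that by (auto simp: ereal_epigraph_def)
    moreover have "convex (ereal_epigraph h)"
      using h by (simp add: proper_closed_convex_def)
    ultimately have "(1 - t) *\<^sub>R (z, real_of_ereal (h z)) + t *\<^sub>R (w, real_of_ereal (h w))
        \<in> ereal_epigraph h"
      using that by (intro convexD) auto
    then show ?thesis by (simp add: ereal_epigraph_def)
  qed
  have dom: "convex (eff_dom h)"
    unfolding convex_alt
  proof (intro ballI allI impI)
    fix z w and t :: real
    assume "z \<in> eff_dom h" "w \<in> eff_dom h" "0 \<le> t \<and> t \<le> 1"
    then have "h ((1 - t) *\<^sub>R z + t *\<^sub>R w) < \<infinity>"
      by (intro le_less_trans[OF seg]) auto
    then show "(1 - t) *\<^sub>R z + t *\<^sub>R w \<in> eff_dom h" by (simp add: eff_dom_def)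
  qed
  show ?thesis
  proof (rule convex_onI[OF _ dom])
    fix t :: real and z w
    assume *: "0 < t" "t < 1" "z \<in> eff_dom h" "w \<in> eff_dom h"
    then have "(1 - t) *\<^sub>R z + t *\<^sub>R w \<in> eff_dom h"
      using dom by (intro convexD) auto
    from proper_closed_convex_finite[OF h this] seg[of t z w] *
    show "real_of_ereal (h ((1 - t) *\<^sub>R z + t *\<^sub>R w))
        \<le> (1 - t) * real_of_ereal (h z) + t * real_of_ereal (h w)"
      by (metis ereal_less_eq(3) less_imp_le)
  qed
qed

section \<open>Descent inequalities for the two block updates\<close>

text \<open>The minimizer \<open>x'\<close> is compared with the point at fraction \<open>a\<close>
  of the way from \<open>z\<close> to \<open>w\<close>, so the proximal term on the right carries
  \<open>a\<^sup>2\<close>. On the left, the \<open>H\<close> part of that term absorbs the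
  curvature of \<open>f1\<close> up to \<open>e\<close>, and the \<open>lam * b\<close> part
  dominates the quadratic part of the penalty with residual \<open>r\<close>.\<close>

lemma prox_step:
  fixes A :: "'a::euclidean_space \<Rightarrow> 'e::euclidean_space"
  assumes A: "linear A" and cvx: "convex_on S f2" and S: "z \<in> S" "w \<in> S"
    and a: "0 \<le> a" "a \<le> 1" and b: "0 \<le> b"
    and tangent: "f1 z + d \<bullet> (w - z) \<le> f1 w"
    and descent: "f1 x' \<le> f1 z + d \<bullet> (x' - z) + H / 2 * (norm (x' - z))\<^sup>2 + e"
    and lam: "(norm (A (x' - z)))\<^sup>2 \<le> lam * (norm (x' - z))\<^sup>2"
    and opt: "\<And>v. v \<in> S \<Longrightarrow>
      (d + b *\<^sub>R adjoint A r) \<bullet> (x' - z) + (H + lam * b) / 2 * (norm (x' - z))\<^sup>2 + f2 x'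
      \<le> (d + b *\<^sub>R adjoint A r) \<bullet> (v - z) + (H + lam * b) / 2 * (norm (v - z))\<^sup>2 + f2 v"
  shows "f1 x' + f2 x' + b / 2 * (norm (r + A (x' - z)))\<^sup>2
    \<le> (1 - a) * (f1 z + f2 z) + a * (f1 w + f2 w) + b / 2 * (norm r)\<^sup>2
      + a * b * (r \<bullet> A (w - z)) + (H + lam * b) / 2 * a\<^sup>2 * (norm (w - z))\<^sup>2 + e"
proof -
  define v where "v = (1 - a) *\<^sub>R z + a *\<^sub>R w"
  have v: "v - z = a *\<^sub>R (w - z)" by (simp add: v_def algebra_simps)
  have "v \<in> S"
    unfolding v_def using S a convex_on_imp_convex[OF cvx] by (intro convexD) auto
  have f2v: "f2 v \<le> (1 - a) * f2 z + a * f2 w"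
    unfolding v_def using convex_onD[OF cvx, of a z w] S a by simp
  have adj: "adjoint A r \<bullet> q = r \<bullet> A q" for q
    using adjoint_works[OF A, of q r] by (simp add: inner_commute)
  have nv: "norm (v - z) = a * norm (w - z)" using a by (simp add: v)
  have Av: "A (v - z) = a *\<^sub>R A (w - z)" using A by (simp add: v linear_scale)
  have dv: "d \<bullet> (v - z) = a * (d \<bullet> (w - z))" by (simp add: v)
  have "d \<bullet> (x' - z) + b * (r \<bullet> A (x' - z)) + (H + lam * b) / 2 * (norm (x' - z))\<^sup>2 + f2 x'
      \<le> a * (d \<bullet> (w - z)) + a * b * (r \<bullet> A (w - z))
        + (H + lam * b) / 2 * a\<^sup>2 * (norm (w - z))\<^sup>2 + f2 v"
    using opt[OF \<open>v \<in> S\<close>]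
    by (simp add: inner_add_left adj nv Av dv power_mult_distrib mult_ac)
  moreover have "b / 2 * (norm (r + A (x' - z)))\<^sup>2
      = b / 2 * (norm r)\<^sup>2 + b * (r \<bullet> A (x' - z)) + b / 2 * (norm (A (x' - z)))\<^sup>2"
    by (simp add: power2_norm_eq_inner inner_add_left inner_add_right inner_commute algebra_simps)
  moreover have "b / 2 * (norm (A (x' - z)))\<^sup>2 \<le> b / 2 * (lam * (norm (x' - z))\<^sup>2)"
    using lam b by (intro mult_left_mono) auto
  moreover have "a * (f1 z + d \<bullet> (w - z)) \<le> a * f1 w"
    using tangent a by (intro mult_left_mono) auto
  ultimately show ?thesis
    using descent f2v by (simp add: algebra_simps add_divide_distrib)
qed

text \<open>Optimality of \<open>u\<close> against \<open>w\<close> is scaled by \<open>a\<close>,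
  since \<open>y'\<close> moves only that fraction towards \<open>u\<close>. The subproblem has no
  proximal term to absorb the quadratic part of the penalty, which stays as an error of order
  \<open>a\<^sup>2\<close>.\<close>

lemma conditional_gradient_step:
  fixes B :: "'b::euclidean_space \<Rightarrow> 'e::euclidean_space"
  assumes B: "linear B" and cvx: "convex_on S g2" and S: "z \<in> S" "u \<in> S" "w \<in> S"
    and a: "0 \<le> a" "a \<le> 1" and b: "0 \<le> b"
    and y': "y' = z + a *\<^sub>R (u - z)"
    and tangent: "g1 z + d \<bullet> (w - z) \<le> g1 w"
    and descent: "g1 y' \<le> g1 z + d \<bullet> (y' - z) + e"
    and lam: "(norm (B (u - z)))\<^sup>2 \<le> lam * (norm (u - z))\<^sup>2"
    and opt: "\<And>v. v \<in> S \<Longrightarrow>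
      (d + b *\<^sub>R adjoint B r) \<bullet> u + g2 u \<le> (d + b *\<^sub>R adjoint B r) \<bullet> v + g2 v"
  shows "g1 y' + g2 y' + b / 2 * (norm (r + B (y' - z)))\<^sup>2
    \<le> (1 - a) * (g1 z + g2 z) + a * (g1 w + g2 w) + b / 2 * (norm r)\<^sup>2
      + a * b * (r \<bullet> B (w - z)) + b / 2 * a\<^sup>2 * lam * (norm (u - z))\<^sup>2 + e"
proof -
  interpret B: linear B by (rule B)
  have y'z: "y' - z = a *\<^sub>R (u - z)" by (simp add: y')
  have g2y: "g2 y' \<le> (1 - a) * g2 z + a * g2 u"
    using convex_onD[OF cvx, of a z u] S a by (simp add: y' algebra_simps)
  have adj: "adjoint B r \<bullet> q = r \<bullet> B q" for q
    using adjoint_works[OF B, of q r] by (simp add: inner_commute)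
  have "a * (d \<bullet> (u - z) + b * (r \<bullet> B (u - z)) + g2 u)
      \<le> a * (d \<bullet> (w - z) + b * (r \<bullet> B (w - z)) + g2 w)"
    using opt[OF \<open>w \<in> S\<close>] a(1)
    by (intro mult_left_mono) (auto simp: inner_add_left inner_diff_right adj B.diff algebra_simps)
  moreover have "b / 2 * (norm (r + B (y' - z)))\<^sup>2 = b / 2 * (norm r)\<^sup>2
      + a * b * (r \<bullet> B (u - z)) + b / 2 * a\<^sup>2 * (norm (B (u - z)))\<^sup>2"
    unfolding y'z B.scaleR power2_norm_add_scaleR by (simp add: algebra_simps)
  moreover have "b / 2 * a\<^sup>2 * (norm (B (u - z)))\<^sup>2 \<le> b / 2 * a\<^sup>2 * (lam * (norm (u - z))\<^sup>2)"
    using lam b by (intro mult_left_mono) auto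
  moreover have "a * (g1 z + d \<bullet> (w - z)) \<le> a * g1 w"
    using tangent a by (intro mult_left_mono) auto
  moreover have "d \<bullet> (y' - z) = a * (d \<bullet> (u - z))" by (simp add: y'z)
  ultimately show ?thesis
    using descent g2y by (simp add: algebra_simps add_divide_distrib)
qed

section \<open>Absorbing a Hoelder error into a quadratic term\<close>

text \<open>One of the two summands suffices in each case: \<open>r\<^sup>2\<close> if
  \<open>q \<le> r powr (1 - \<mu>)\<close>, and the power of \<open>q\<close> otherwise, because
  then \<open>r\<close> is bounded by a power of \<open>q\<close>.\<close>

lemma hoelder_gap:
  fixes r q \<mu> :: real
  assumes "0 < \<mu>" "\<mu> < 1" "0 \<le> q" "0 \<le> r"
  shows "q * r powr (\<mu> + 1) \<le> r\<^sup>2 + q powr (2 / (1 - \<mu>))"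
proof (cases "r = 0 \<or> q = 0")
  case False
  then have pos: "r > 0" "q > 0" using assms by auto
  show ?thesis
  proof (cases "q \<le> r powr (1 - \<mu>)")
    case True
    then have "q * r powr (\<mu> + 1) \<le> r powr (1 - \<mu>) * r powr (\<mu> + 1)"
      by (intro mult_right_mono) auto
    also have "\<dots> = r\<^sup>2" using pos by (simp add: powr_add[symmetric] powr_numeral)
    finally show ?thesis by (simp add: add_increasing2)
  next
    case False
    then have "(r powr (1 - \<mu>)) powr ((\<mu> + 1) / (1 - \<mu>)) \<le> q powr ((\<mu> + 1) / (1 - \<mu>))"
      using assms by (intro powr_mono2) auto
    then have "q * r powr (\<mu> + 1) \<le> q * q powr ((\<mu> + 1) / (1 - \<mu>))"
      using assms by (intro mult_left_mono) (auto simp: powr_powr)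
    also have "\<dots> = q powr (1 + (\<mu> + 1) / (1 - \<mu>))" using pos by (simp add: powr_add)
    also have "1 + (\<mu> + 1) / (1 - \<mu>) = 2 / (1 - \<mu>)" using assms by (simp add: field_simps)
    finally show ?thesis by (simp add: add_increasing)
  qed
qed (use assms in auto)


text \<open>Curvature growing like \<open>t powr (1 - \<mu>)\<close> replaces the Hoelder modulus at
  the price of an excess of order \<open>t powr (- 1 - \<mu>)\<close>. For \<mu> = 1 the modulus is
  already quadratic and \<open>H'\<close> dominates it without excess.\<close>

lemma prox_error_bound:
  fixes M H' \<mu> r t :: real
  assumes \<mu>: "0 < \<mu>" "\<mu> \<le> 1" and M: "0 \<le> M" and H': "0 < H'" "2 * M / (\<mu> + 1) \<le> H'"
    and t: "0 < t" and r: "0 \<le> r"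
  shows "M / (\<mu> + 1) * r powr (\<mu> + 1) \<le> H' * t powr (1 - \<mu>) / 2 * r\<^sup>2
    + (if \<mu> < 1 then H' / 2 * (2 * M / ((1 + \<mu>) * H')) powr (2 / (1 - \<mu>))
        * (t powr (1 - \<mu>) / t\<^sup>2) else 0)"
proof (cases "\<mu> < 1")
  case True
  define h q where "h = H' * t powr (1 - \<mu>)" and "q = 2 * M / ((1 + \<mu>) * H')"
  have q: "0 \<le> q" using \<mu> M H' by (simp add: q_def)
  have h: "0 < h" using t H' by (simp add: h_def)
  \<comment> \<open>The coefficient is chosen so that multiplication by \<open>h / 2\<close>
    restores \<open>M / (\<mu> + 1)\<close>; the exponent \<open>2 / (1 - \<mu>)\<close> turns its
    denominator into \<open>t\<^sup>2\<close>.\<close>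
  have "(q / t powr (1 - \<mu>)) * r powr (\<mu> + 1)
      \<le> r\<^sup>2 + (q / t powr (1 - \<mu>)) powr (2 / (1 - \<mu>))"
    using hoelder_gap[OF \<mu>(1) True _ r, of "q / t powr (1 - \<mu>)"] q by simp
  also have "(q / t powr (1 - \<mu>)) powr (2 / (1 - \<mu>)) = q powr (2 / (1 - \<mu>)) / t\<^sup>2"
  proof -
    have "(t powr (1 - \<mu>)) powr (2 / (1 - \<mu>)) = t powr ((1 - \<mu>) * (2 / (1 - \<mu>)))"
      by (rule powr_powr)
    also have "(1 - \<mu>) * (2 / (1 - \<mu>)) = 2"
    proof -
      have k: "k * (2 / k) = 2" if "k \<noteq> 0" for k :: real using that by simp
      show ?thesis by (rule k) (use True in simp)
    qed
    finally show ?thesis using q t by (simp add: powr_divide powr_numeral)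
  qed
  finally have le: "h / 2 * ((q / t powr (1 - \<mu>)) * r powr (\<mu> + 1))
      \<le> h / 2 * (r\<^sup>2 + q powr (2 / (1 - \<mu>)) / t\<^sup>2)"
    using h by (intro mult_left_mono) auto
  have "h / 2 * (q / t powr (1 - \<mu>)) = M / (\<mu> + 1)"
  proof -
    have "a * b / 2 * (2 * M / (c * a) / b) = M / c" if "a \<noteq> 0" "b \<noteq> 0" for a b c :: real
      using that by simp
    then show ?thesis using t H' by (simp add: h_def q_def add.commute)
  qed
  then have lhs: "h / 2 * ((q / t powr (1 - \<mu>)) * r powr (\<mu> + 1)) = M / (\<mu> + 1) * r powr (\<mu> + 1)"
    by (simp only: mult.assoc[symmetric])
  have rhs: "h / 2 * (r\<^sup>2 + q powr (2 / (1 - \<mu>)) / t\<^sup>2) = H' * t powr (1 - \<mu>) / 2 * r\<^sup>2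
      + H' / 2 * q powr (2 / (1 - \<mu>)) * (t powr (1 - \<mu>) / t\<^sup>2)"
    by (simp add: h_def distrib_left)
  show ?thesis
    using le unfolding lhs rhs by (simp only: True if_True q_def)
next
  case False
  then have "\<mu> = 1" using \<mu> by simp
  moreover have "M / 2 * r\<^sup>2 \<le> H' / 2 * r\<^sup>2"
    using H' \<open>\<mu> = 1\<close> by (intro mult_right_mono) auto
  ultimately show ?thesis using t r by (simp add: powr_numeral)
qed

section \<open>Summation by parts, weights and step sizes\<close>

text \<open>Abel summation shifts the difference from \<open>a\<close> onto \<open>b\<close> and
  \<open>w\<close>. As \<open>w\<close> is nondecreasing, its increments telescope to a multiple of
  \<open>w m\<close>.\<close>

lemma summation_by_parts_bound:
  fixes a b :: "nat \<Rightarrow> 'e::real_inner" and w :: "nat \<Rightarrow> real"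
  assumes w: "\<And>s. 1 \<le> s \<Longrightarrow> 0 \<le> w s" "\<And>s. 1 \<le> s \<Longrightarrow> w s \<le> w (Suc s)"
    and ab: "\<And>s. 1 \<le> s \<Longrightarrow> \<bar>a s \<bullet> b s\<bar> \<le> K"
    and d: "\<And>s. 1 \<le> s \<Longrightarrow> w s * \<bar>a (Suc s) \<bullet> (b (Suc s) - b s)\<bar> \<le> d s"
    and "1 \<le> m"
  shows "(\<Sum>s\<in>{1..<m}. w s * ((a (Suc s) - a s) \<bullet> b s)) \<le> 2 * K * w m + (\<Sum>s\<in>{1..<m}. d s)"
proof -
  \<comment> \<open>The induction carries the boundary term inside the absolute value; removing it
    at the end costs a second \<open>K * w m\<close>.\<close>
  have "\<bar>(\<Sum>s\<in>{1..<m}. w s * ((a (Suc s) - a s) \<bullet> b s)) - w m * (a m \<bullet> b m)\<bar>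
      \<le> K * w m + (\<Sum>s\<in>{1..<m}. d s)"
    using \<open>1 \<le> m\<close>
  proof (induction m rule: dec_induct)
    case base
    show ?case using w(1)[of 1] mult_left_mono[OF ab[of 1], of "w 1"]
      by (simp add: abs_mult mult.commute)
  next
    case (step n)
    have n: "1 \<le> n" using step by simp
    have "\<bar>(w (Suc n) - w n) * (a (Suc n) \<bullet> b (Suc n))\<bar> \<le> (w (Suc n) - w n) * K"
      using w(2)[OF n] ab[of "Suc n"] by (auto simp: abs_mult intro!: mult_left_mono)
    moreover have "\<bar>w n * (a (Suc n) \<bullet> (b (Suc n) - b n))\<bar> \<le> d n"
      using d[OF n] w(1)[OF n] by (simp add: abs_mult)
    moreover have "w n * ((a (Suc n) - a n) \<bullet> b n) - w (Suc n) * (a (Suc n) \<bullet> b (Suc n))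
        = - (w n * (a n \<bullet> b n)) - (w (Suc n) - w n) * (a (Suc n) \<bullet> b (Suc n))
          - w n * (a (Suc n) \<bullet> (b (Suc n) - b n))"
      by (simp add: inner_diff_left inner_diff_right algebra_simps)
    ultimately show ?case
      using step.IH n by (simp add: sum.atLeastLessThan_Suc algebra_simps)
  qed
  moreover have "w m * (a m \<bullet> b m) \<le> w m * K"
    using w(1) ab[of m] \<open>1 \<le> m\<close> by (intro mult_left_mono) auto
  ultimately show ?thesis by (simp add: algebra_simps)
qed

text \<open>The weight \<open>(t + 1) * (t + 2)\<close> turns the factor \<open>t / (t + 2)\<close>
  into the preceding weight \<open>t * (t + 1)\<close>, so the recursion telescopes.\<close>

lemma weighted_recursion:
  fixes P c E :: "nat \<Rightarrow> real"
  assumes step: "\<And>t. 1 \<le> t \<Longrightarrow>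
      P (Suc t) \<le> real t / (real t + 2) * P t + 2 / (real t + 2) * c t + E t"
    and "1 \<le> m"
  shows "real m * (real m + 1) * P m \<le> 2 * P 1 + (\<Sum>s\<in>{1..<m}. 2 * (real s + 1) * c s)
    + (\<Sum>s\<in>{1..<m}. (real s + 1) * (real s + 2) * E s)"
  using \<open>1 \<le> m\<close>
proof (induction m rule: dec_induct)
  case (step n)
  have "(real n + 1) * (real n + 2) * P (Suc n)
      \<le> (real n + 1) * (real n + 2) *
        (real n / (real n + 2) * P n + 2 / (real n + 2) * c n + E n)"
    using assms(1)[of n] step by (intro mult_left_mono) auto
  also have "\<dots> = real n * (real n + 1) * P n + 2 * (real n + 1) * c n
      + (real n + 1) * (real n + 2) * E n"
  proof -
    have "a * k * (l / k * p + 2 / k * q + e) = l * a * p + 2 * a * q + a * k * e"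
      if "k \<noteq> 0" for a k l p q e :: real
      using that by (simp add: distrib_left)
    then show ?thesis by simp
  qed
  finally show ?case
    using step by (simp add: sum.atLeastLessThan_Suc algebra_simps)
qed simp

lemma stepsize_square_weight:
  fixes s :: real
  assumes "0 \<le> s" "0 \<le> K"
  shows "(s + 1) * (s + 2) * (K * (2 / (s + 2))\<^sup>2) \<le> 4 * K"
proof -
  have "(s + 1) * (s + 2) * (K * (2 / (s + 2))\<^sup>2) = 4 * K * ((s + 1) / (s + 2))"
    using assms by (simp add: power2_eq_square divide_simps)
  also have "\<dots> \<le> 4 * K * 1"
    using assms by (intro mult_left_mono) auto
  finally show ?thesis by simp
qed

text \<open>For \<nu> < 1 the step size does not fully cancel the weight. The growth left over
  yields the rate \<nu> once a sum of at most \<open>m\<close> such terms is divided by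
  \<open>m * (m + 1)\<close>.\<close>

lemma stepsize_powr_weight:
  fixes s \<nu> :: real
  assumes "0 \<le> s"
  shows "(s + 1) * (s + 2) * (2 / (s + 2)) powr (\<nu> + 1) \<le> 2 powr (\<nu> + 1) * (s + 2) powr (1 - \<nu>)"
proof -
  have "(s + 1) * (s + 2) * (2 / (s + 2)) powr (\<nu> + 1)
      \<le> (s + 2)\<^sup>2 * (2 / (s + 2)) powr (\<nu> + 1)"
    using assms by (intro mult_right_mono) (auto simp: power2_eq_square intro: mult_right_mono)
  also have "\<dots> = 2 powr (\<nu> + 1) * ((s + 2) powr 2 / (s + 2) powr (\<nu> + 1))"
    using assms by (simp add: powr_divide powr_numeral)
  also have "(s + 2) powr 2 / (s + 2) powr (\<nu> + 1) = (s + 2) powr (1 - \<nu>)"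
    by (simp flip: powr_diff)
  finally show ?thesis .
qed

text \<open>This compares the penalties of two consecutive iterations, up to the factor
  \<open>\<beta> 0\<close>. It rests on \<open>(1 + 1 / t) powr \<delta> \<le> 1 + 1 / t\<close> and
  \<open>(t - 2) * (t + 1) \<le> t * t\<close>; for \<open>t \<le> 2\<close> the left side is not
  positive.\<close>

lemma penalty_weight:
  fixes t \<delta> :: real
  assumes t: "1 \<le> t" and \<delta>: "0 \<le> \<delta>" "\<delta> \<le> 1"
  shows "(1 - 2 * (2 / (t + 2))) * (t + 1) powr \<delta> \<le> (1 - 2 / (t + 2)) * t powr \<delta>"
proof -
  have "(t + 1) powr \<delta> = t powr \<delta> * (1 + 1 / t) powr \<delta>"
    using t by (simp add: distrib_left flip: powr_mult)
  also have "(1 + 1 / t) powr \<delta> \<le> (1 + 1 / t) powr 1"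
    using t \<delta> by (intro powr_mono) auto
  finally have le: "(t + 1) powr \<delta> \<le> t powr \<delta> * (1 + 1 / t)"
    using t by (simp add: mult_left_mono)
  show ?thesis
  proof (cases "t \<le> 2")
    case True
    then have "(1 - 2 * (2 / (t + 2))) * (t + 1) powr \<delta> \<le> 0"
      using t by (intro mult_nonpos_nonneg) (auto simp: field_simps)
    also have "0 \<le> (1 - 2 / (t + 2)) * t powr \<delta>" using t by simp
    finally show ?thesis .
  next
    case False
    have eqs: "1 - 2 * (2 / (t + 2)) = (t - 2) / (t + 2)" "1 - 2 / (t + 2) = t / (t + 2)"
      "1 + 1 / t = (t + 1) / t"
      using t by (auto simp: field_simps)
    have "(t - 2) / (t + 2) * (t + 1) powr \<delta>
        \<le> (t - 2) / (t + 2) * (t powr \<delta> * ((t + 1) / t))"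
      using le False unfolding eqs by (intro mult_left_mono) auto
    also have "\<dots> = ((t - 2) * (t + 1) / t) / (t + 2) * t powr \<delta>"
      by (simp add: mult_ac)
    also have "\<dots> \<le> t / (t + 2) * t powr \<delta>"
      using t by (intro mult_right_mono divide_right_mono) (auto simp: pos_divide_le_eq algebra_simps)
    finally show ?thesis unfolding eqs .
  qed
qed

section \<open>From the summed recursion to rates\<close>

text \<open>After multiplication by \<open>m * (m + 1)\<close> a term with denominator
  \<open>(m + 1) powr r\<close> becomes \<open>m * (m + 1) powr (1 - r)\<close>, so each group in
  the hypothesis on \<open>Q\<close> meets one term of the claim.\<close>

lemma rate_bound:
  fixes m \<delta> \<nu> \<mu> Q \<theta> K C1 C2 C3 C4 :: real
  assumes m: "1 \<le> m" and \<delta>: "0 < \<delta>" "\<delta> < 1" and K: "0 \<le> K"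
    and C: "0 \<le> C2" "0 \<le> C3" "0 \<le> C4"
    and C1: "\<theta> \<le> C1"
    and Q: "m * (m + 1) * Q \<le> \<theta> + 8 * K * ((m + 1) powr (1 + \<delta>) + m powr (1 + \<delta>))
      + m * (C2 * m powr \<delta> + C3 * (m + 1) powr (1 - \<nu>) + C4 * (m + 1) powr (1 - \<mu>))"
  shows "Q \<le> C1 / (m * (m + 1)) + (C2 + (32 + 16 * \<delta>) / (1 + \<delta>) * K) / (m + 1) powr (1 - \<delta>)
      + C3 / (m + 1) powr \<nu> + C4 / (m + 1) powr \<mu>"
proof -
  have inv: "m * (m + 1) * (1 / (m + 1) powr r) = m * (m + 1) powr (1 - r)" for r
    using m by (simp add: powr_diff)
  have m\<delta>: "m powr \<delta> \<le> (m + 1) powr \<delta>"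
    using m \<delta> by (intro powr_mono2) auto
  \<comment> \<open>The coefficient decreases in \<delta> and equals 24 at \<delta> = 1. The cross
    terms need 8 times 3, where 3 comes from \<open>m + 1 \<le> 2 * m\<close>.\<close>
  have "24 \<le> (32 + 16 * \<delta>) / (1 + \<delta>)" using \<delta> by (simp add: field_simps)
  then have "24 * K * (m * (m + 1) powr \<delta>) \<le> (32 + 16 * \<delta>) / (1 + \<delta>) * K * (m * (m + 1) powr \<delta>)"
    using K m by (intro mult_right_mono) auto
  moreover have "8 * K * ((m + 1) powr (1 + \<delta>) + m powr (1 + \<delta>)) \<le> 24 * K * (m * (m + 1) powr \<delta>)"
  proof -
    have "(m + 1) * (m + 1) powr \<delta> \<le> (2 * m) * (m + 1) powr \<delta>"
      using m by (intro mult_right_mono) auto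
    moreover have "m * m powr \<delta> \<le> m * (m + 1) powr \<delta>"
      using m m\<delta> by (intro mult_left_mono) auto
    moreover have "(m + 1) powr (1 + \<delta>) = (m + 1) * (m + 1) powr \<delta>" "m powr (1 + \<delta>) = m * m powr \<delta>"
      using m by (simp_all add: powr_add)
    ultimately have "(m + 1) powr (1 + \<delta>) + m powr (1 + \<delta>) \<le> 3 * (m * (m + 1) powr \<delta>)"
      by linarith
    from mult_left_mono[OF this, of "8 * K"] K show ?thesis by (simp add: mult_ac)
  qed
  moreover have "C2 * (m * m powr \<delta>) \<le> C2 * (m * (m + 1) powr \<delta>)"
    using C m m\<delta> by (intro mult_left_mono) auto
  moreover have "m * (m + 1) * (C1 / (m * (m + 1)) + (C2 + (32 + 16 * \<delta>) / (1 + \<delta>) * K) / (m + 1) powr (1 - \<delta>)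
      + C3 / (m + 1) powr \<nu> + C4 / (m + 1) powr \<mu>)
    = C1 + (C2 + (32 + 16 * \<delta>) / (1 + \<delta>) * K) * (m * (m + 1) * (1 / (m + 1) powr (1 - \<delta>)))
      + C3 * (m * (m + 1) * (1 / (m + 1) powr \<nu>)) + C4 * (m * (m + 1) * (1 / (m + 1) powr \<mu>))"
  proof -
    have "k * (a / k + b / p + c / q + d / r)
        = a + b * (k * (1 / p)) + c * (k * (1 / q)) + d * (k * (1 / r))"
      if "k \<noteq> 0" for a b c d k p q r :: real
      using that by (simp add: distrib_left mult.commute)
    then show ?thesis using m by simp
  qed
  ultimately have "m * (m + 1) * Q \<le> m * (m + 1) * (C1 / (m * (m + 1))
      + (C2 + (32 + 16 * \<delta>) / (1 + \<delta>) * K) / (m + 1) powr (1 - \<delta>)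
      + C3 / (m + 1) powr \<nu> + C4 / (m + 1) powr \<mu>)"
    using Q C1 unfolding inv by (simp add: algebra_simps)
  then show ?thesis using m by simp
qed

text \<open>Completing the square; the bound is the larger root of
  \<open>b / 2 * r\<^sup>2 - L * r = T\<close>.\<close>

lemma quadratic_root_bound:
  fixes b r L T :: real
  assumes "0 < b" "b / 2 * r\<^sup>2 - L * r \<le> T"
  shows "r \<le> L / b + sqrt (L\<^sup>2 / b\<^sup>2 + 2 * T / b)"
proof -
  have "(r - L / b)\<^sup>2 = L\<^sup>2 / b\<^sup>2 + 2 / b * (b / 2 * r\<^sup>2 - L * r)"
    using assms(1) by (simp add: power2_diff power_divide right_diff_distrib)
  also have "\<dots> \<le> L\<^sup>2 / b\<^sup>2 + 2 / b * T"
    using assms by (intro add_left_mono mult_left_mono) auto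
  finally have "r - L / b \<le> sqrt (L\<^sup>2 / b\<^sup>2 + 2 * T / b)"
    by (intro real_le_rsqrt) simp
  then show ?thesis by simp
qed

section \<open>Finite minimizers and bounded domains\<close>

text \<open>Comparison with a point where the proper function \<open>h\<close> is finite shows that
  the minimum is finite, so optimality becomes an inequality between reals on the domain.\<close>

lemma is_arg_min_ereal_addD:
  assumes h: "proper_closed_convex h"
    and w: "is_arg_min (\<lambda>z. ereal (\<phi> z) + h z) (\<lambda>_. True) w"
  shows "w \<in> eff_dom h"
    and "v \<in> eff_dom h \<Longrightarrow> \<phi> w + real_of_ereal (h w) \<le> \<phi> v + real_of_ereal (h v)"
proof -
  have le: "ereal (\<phi> w) + h w \<le> ereal (\<phi> v) + h v" for v
    using w by (auto simp: is_arg_min_def not_less)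
  show w': "w \<in> eff_dom h" using le h by (force simp: eff_dom_def proper_closed_convex_def)
  show "\<phi> w + real_of_ereal (h w) \<le> \<phi> v + real_of_ereal (h v)" if "v \<in> eff_dom h"
    using le[of v] proper_closed_convex_finite[OF h w'] proper_closed_convex_finite[OF h that]
    by (metis ereal_less_eq(3) plus_ereal.simps(1))
qed

lemma bdd_above_diff_imp_bounded:
  assumes "bdd_above {norm (z - w) | z w. z \<in> S \<and> w \<in> S}"
  shows "bounded S"
proof (cases "S = {}")
  case False
  then obtain w where "w \<in> S" by auto
  moreover obtain K where "\<And>z w. z \<in> S \<Longrightarrow> w \<in> S \<Longrightarrow> norm (z - w) \<le> K"
    using assms unfolding bdd_above_def by blast
  ultimately have "dist w z \<le> K" if "z \<in> S" for z
    using that by (simp add: dist_norm)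
  then show ?thesis by (auto simp: bounded_def)
qed simp

text \<open>Ensures that the supremum \<open>D\<^sub>2\<close> is a genuine upper bound.\<close>

lemma bdd_above_inner_linear:
  fixes A :: "'a::euclidean_space \<Rightarrow> 'e::euclidean_space" and B :: "'b::euclidean_space \<Rightarrow> 'e"
  assumes "linear A" "linear B" "bounded S" "bounded T"
  shows "bdd_above {\<bar>A z \<bullet> B w\<bar> | z w. z \<in> S \<and> w \<in> T}"
proof -
  obtain K L where K: "\<And>z. z \<in> S \<Longrightarrow> norm (A z) \<le> K" and L: "\<And>w. w \<in> T \<Longrightarrow> norm (B w) \<le> L"
    using bounded_linear_image[of S A] bounded_linear_image[of T B] assms
    by (auto simp: linear_conv_bounded_linear bounded_iff)
  have "\<bar>A z \<bullet> B w\<bar> \<le> K * L" if "z \<in> S" "w \<in> T" for z w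
    using Cauchy_Schwarz_ineq2[of "A z" "B w"] K[OF that(1)] L[OF that(2)]
    by (meson mult_mono' norm_ge_zero order_trans)
  then show ?thesis by (auto simp: bdd_above_def)
qed

theorem theorem4p1:
  fixes A :: "'a::euclidean_space \<Rightarrow> 'e::euclidean_space"
    and B :: "'b::euclidean_space \<Rightarrow> 'e"
    and c :: 'e
    and f f2 :: "'a \<Rightarrow> ereal" and g g2 :: "'b \<Rightarrow> ereal"
    and f1 :: "'a \<Rightarrow> real" and g1 :: "'b \<Rightarrow> real"
    and grad_f1 :: "'a \<Rightarrow> 'a" and grad_g1 :: "'b \<Rightarrow> 'b"
    and M\<^sub>f M\<^sub>g \<mu> \<nu> \<delta> D\<^sub>f D\<^sub>g D\<^sub>2 lam\<^sub>A lam\<^sub>B :: real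
    and x\<^sub>s :: 'a and y\<^sub>s :: 'b and lbar :: 'e
    and x :: "nat \<Rightarrow> 'a" and y u :: "nat \<Rightarrow> 'b" and R R' :: "nat \<Rightarrow> 'e"
    and \<alpha> \<beta> H \<tau> G :: "nat \<Rightarrow> real"
    and \<omega>\<^sub>0 \<omega>\<^sub>1 \<omega>\<^sub>2 \<omega>\<^sub>3 \<omega>\<^sub>4 \<omega>\<^sub>5 H' \<theta> :: real
  assumes
    \<comment> \<open>problem (P)\<close>
        "linear A" and "linear B"
    and "proper_closed_convex f" and "proper_closed_convex g"
    \<comment> \<open>constraint qualification CQ\<close>
    and "\<exists>x\<in>rel_interior (eff_dom f). \<exists>y\<in>rel_interior (eff_dom g). c = A x + B y"
    \<comment> \<open>assumption (D)\<close>
    and "bdd_above {norm (x1 - x2) | x1 x2. x1 \<in> eff_dom f \<and> x2 \<in> eff_dom f}"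
    and "bdd_above {norm (y1 - y2) | y1 y2. y1 \<in> eff_dom g \<and> y2 \<in> eff_dom g}"
    and "D\<^sub>f = Sup {norm (x1 - x2) | x1 x2. x1 \<in> eff_dom f \<and> x2 \<in> eff_dom f}"
    and "D\<^sub>g = Sup {norm (y1 - y2) | y1 y2. y1 \<in> eff_dom g \<and> y2 \<in> eff_dom g}"
    \<comment> \<open>assumption (S)\<close>
    and "\<And>z. f z = ereal (f1 z) + f2 z" and "\<And>z. g z = ereal (g1 z) + g2 z"
    and "smooth_convex_with_gradient f1 grad_f1" and "smooth_convex_with_gradient g1 grad_g1"
    and "proper_closed_convex f2" and "proper_closed_convex g2"
    and "hoelder_continuous_on (eff_dom f) grad_f1"
    and "hoelder_continuous_on (eff_dom g) grad_g1"
    and "0 < \<mu>" and "\<mu> \<le> 1" and "0 < \<nu>" and "\<nu> \<le> 1" and "0 \<le> M\<^sub>f" and "0 \<le> M\<^sub>g"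
    and "\<And>z w. z \<in> eff_dom f \<Longrightarrow> w \<in> eff_dom f \<Longrightarrow>
           f1 w \<le> f1 z + grad_f1 z \<bullet> (w - z) + M\<^sub>f / (\<mu> + 1) * norm (w - z) powr (\<mu> + 1)"
    and "\<And>z w. z \<in> eff_dom g \<Longrightarrow> w \<in> eff_dom g \<Longrightarrow>
           g1 w \<le> g1 z + grad_g1 z \<bullet> (w - z) + M\<^sub>g / (\<nu> + 1) * norm (w - z) powr (\<nu> + 1)"
    and "\<And>v. \<exists>w. is_arg_min (\<lambda>z. ereal (v \<bullet> z) + g2 z) (\<lambda>_. True) w"
    \<comment> \<open>a solution and a multiplier\<close>
    and "solves_P f g A B c x\<^sub>s y\<^sub>s"
    and "0 \<in> (\<lambda>v. v + adjoint A lbar) ` subdifferential f x\<^sub>s"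
    and "0 \<in> (\<lambda>v. v + adjoint B lbar) ` subdifferential g y\<^sub>s"
    \<comment> \<open>the algorithm\<close>
    and "lam\<^sub>A = lambda_max (adjoint A \<circ> A)" and "lam\<^sub>B = lambda_max (adjoint B \<circ> B)"
    and "x 0 \<in> eff_dom f" and "y 0 \<in> eff_dom g"
    and "0 < \<beta> 0" and "0 < H 0" and "0 < \<delta>" and "\<delta> < 1"
    and "\<And>t. \<alpha> t = 2 / (real t + 2)"
    and "\<And>t. R t = A (x t) + B (y t) - c"
    and "\<And>t. is_arg_min
           (\<lambda>z. ereal ((grad_f1 (x t) + \<beta> t *\<^sub>R adjoint A (R t)) \<bullet> (z - x t)
                    + (H t + lam\<^sub>A * \<beta> t) / 2 * (norm (z - x t))\<^sup>2) + f2 z)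
           (\<lambda>_. True) (x (Suc t))"
    and "\<And>t. R' t = A (x (Suc t)) + B (y t) - c"
    and "\<And>t. is_arg_min
           (\<lambda>z. ereal ((grad_g1 (y t) + \<beta> t *\<^sub>R adjoint B (R' t)) \<bullet> z) + g2 z)
           (\<lambda>_. True) (u t)"
    and "\<And>t. y (Suc t) = y t + \<alpha> t *\<^sub>R (u t - y t)"
    and "\<And>t. H (Suc t) = max (H 0) (2 * M\<^sub>f / (\<mu> + 1)) * (real t + 1) powr (1 - \<mu>)"
    and "\<And>t. \<beta> (Suc t) = \<beta> 0 * (real t + 2) powr \<delta>"
    \<comment> \<open>the constants of the bound; the values of f and g entering \<open>\<theta>\<close> are all finite\<close>
    and "D\<^sub>2 = Sup {\<bar>A z \<bullet> B w\<bar> | z w. z \<in> eff_dom f \<and> w \<in> eff_dom g}"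
    and "\<theta> = 2 * (real_of_ereal (f (x 1)) + real_of_ereal (g (y 1))
                 + \<beta> 0 / 2 * (norm (A (x 1) + B (y 1) - c))\<^sup>2
                 - real_of_ereal (f x\<^sub>s) - real_of_ereal (g y\<^sub>s))"
    and "H' = max (H 0) (2 * M\<^sub>f / (\<mu> + 1))"
    and "\<omega>\<^sub>0 = 4 * H' * (2 * M\<^sub>f / ((1 + \<mu>) * H')) powr (2 / (1 - \<mu>))"
    and "\<omega>\<^sub>1 = 2 powr (\<delta> + 3) * \<beta> 0 * D\<^sub>2 + \<theta>"
    and "\<omega>\<^sub>2 = 2 * lam\<^sub>A * D\<^sub>f\<^sup>2 * \<beta> 0 + 2 * lam\<^sub>B * D\<^sub>g\<^sup>2 * \<beta> 0
              + (32 + 16 * \<delta>) / (1 + \<delta>) * D\<^sub>2 * \<beta> 0"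
    and "\<omega>\<^sub>3 = 2 powr (\<nu> + 1) / (\<nu> + 1) * M\<^sub>g * D\<^sub>g powr (\<nu> + 1)"
    and "\<omega>\<^sub>4 = 2 * H' * D\<^sub>f\<^sup>2 + 2 * \<omega>\<^sub>0"
    and "\<omega>\<^sub>5 = 2 * H' * D\<^sub>f\<^sup>2"
    and "\<And>t. \<tau> t = (if \<mu> < 1
           then \<omega>\<^sub>1 / (real t * (real t + 1)) + \<omega>\<^sub>2 / (real t + 1) powr (1 - \<delta>)
                + \<omega>\<^sub>3 / (real t + 1) powr \<nu> + \<omega>\<^sub>4 / (real t + 1) powr \<mu>
           else \<omega>\<^sub>1 / (real t * (real t + 1)) + \<omega>\<^sub>2 / (real t + 1) powr (1 - \<delta>)
                + \<omega>\<^sub>3 / (real t + 1) powr \<nu> + \<omega>\<^sub>5 / (real t + 1))"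
    and "\<And>t. G t = norm lbar / (\<beta> 0 * real t powr \<delta>)
           + sqrt ((norm lbar)\<^sup>2 / ((\<beta> 0)\<^sup>2 * real t powr (2 * \<delta>))
                   + 2 * \<tau> t / (\<beta> 0 * real t powr \<delta>))"
  shows "bdd_above {\<bar>A z \<bullet> B w\<bar> | z w. z \<in> eff_dom f \<and> w \<in> eff_dom g} \<and>
    (\<forall>t\<ge>2.
       \<bar>f (x t) + g (y t) - f x\<^sub>s - g y\<^sub>s\<bar> \<le> ereal (max (\<tau> t) (norm lbar * G t)) \<and>
       norm (A (x t) + B (y t) - c) \<le> G t)"
proof -

  \<comment> \<open>Real-valued data, finiteness and domains of the iterates\<close>
  interpret A: linear A by (rule assms(1))
  interpret B: linear B by (rule assms(2))
  define p2 q2 where "p2 = (\<lambda>z. real_of_ereal (f2 z))" and "q2 = (\<lambda>z. real_of_ereal (g2 z))"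
  have domf: "eff_dom f2 = eff_dom f" and domg: "eff_dom g2 = eff_dom g"
    by (auto simp: eff_dom_def assms(10,11))
  have fval: "f z = ereal (f1 z + p2 z)" if "z \<in> eff_dom f" for z
  proof -
    have "f2 z = ereal (p2 z)"
      unfolding p2_def by (rule proper_closed_convex_finite[OF assms(14)]) (simp add: domf that)
    then show ?thesis by (simp add: assms(10))
  qed
  have gval: "g z = ereal (g1 z + q2 z)" if "z \<in> eff_dom g" for z
  proof -
    have "g2 z = ereal (q2 z)"
      unfolding q2_def by (rule proper_closed_convex_finite[OF assms(15)]) (simp add: domg that)
    then show ?thesis by (simp add: assms(11))
  qed
  have cvxf: "convex_on (eff_dom f) p2" and cvxg: "convex_on (eff_dom g) q2"
    using proper_closed_convex_convex_on[OF assms(14)] proper_closed_convex_convex_on[OF assms(15)]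
    by (simp_all add: domf domg p2_def q2_def)

  have feas: "A x\<^sub>s + B y\<^sub>s = c" using assms(27) by (simp add: solves_P_def)
  have xs: "x\<^sub>s \<in> eff_dom f" and ys: "y\<^sub>s \<in> eff_dom g"
  proof -
    \<comment> \<open>The constraint qualification supplies a feasible pair of finite value. The
      optimal value is then finite from above, and since neither summand is negative infinity both
      are finite.\<close>
    obtain x0 y0 where "x0 \<in> eff_dom f" "y0 \<in> eff_dom g" "A x0 + B y0 = c"
      using assms(5) rel_interior_subset[of "eff_dom f"] rel_interior_subset[of "eff_dom g"]
      by (metis subsetD)
    then have "f x\<^sub>s + g y\<^sub>s \<le> f x0 + g y0" "f x0 + g y0 < \<infinity>"
      using assms(27) by (auto simp: solves_P_def eff_dom_def)
    then have "f x\<^sub>s + g y\<^sub>s < \<infinity>" by (rule le_less_trans)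
    moreover have "f x\<^sub>s \<noteq> -\<infinity>" "g y\<^sub>s \<noteq> -\<infinity>"
      using assms(3,4) by (auto simp: proper_closed_convex_def)
    ultimately show "x\<^sub>s \<in> eff_dom f" "y\<^sub>s \<in> eff_dom g"
      by (auto simp: eff_dom_def)
  qed

  note x_opt = is_arg_min_ereal_addD[OF assms(14) assms(40), unfolded domf]
  note u_opt = is_arg_min_ereal_addD[OF assms(15) assms(42), unfolded domg]
  have xd: "x t \<in> eff_dom f" for t using assms(32) x_opt(1) by (cases t) auto
  have ud: "u t \<in> eff_dom g" for t by (rule u_opt(1))
  have \<alpha>: "\<alpha> t = 2 / (real t + 2)" "0 \<le> \<alpha> t" "\<alpha> t \<le> 1" for t
    by (simp_all add: assms(38))
  have yd: "y t \<in> eff_dom g" for t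
  proof (induction t)
    case (Suc t)
    have "y (Suc t) = (1 - \<alpha> t) *\<^sub>R y t + \<alpha> t *\<^sub>R u t" by (simp add: assms(43) algebra_simps)
    then show ?case
      using Suc ud \<alpha>[of t] convexD[OF convex_on_imp_convex[OF cvxg], of "y t" "u t" "1 - \<alpha> t" "\<alpha> t"]
      by simp
  qed (rule assms(33))

  \<comment> \<open>Diameters, inner products, operator bounds and the Lagrangian\<close>
  have Df: "norm (z - w) \<le> D\<^sub>f" if "z \<in> eff_dom f" "w \<in> eff_dom f" for z w
    unfolding assms(8) by (rule cSup_upper[OF _ assms(6)]) (use that in blast)
  have Dg: "norm (z - w) \<le> D\<^sub>g" if "z \<in> eff_dom g" "w \<in> eff_dom g" for z w
    unfolding assms(9) by (rule cSup_upper[OF _ assms(7)]) (use that in blast)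
  have bdd: "bdd_above {\<bar>A z \<bullet> B w\<bar> | z w. z \<in> eff_dom f \<and> w \<in> eff_dom g}"
    by (intro bdd_above_inner_linear bdd_above_diff_imp_bounded assms(1,2,6,7))
  have D2: "\<bar>A z \<bullet> B w\<bar> \<le> D\<^sub>2" if "z \<in> eff_dom f" "w \<in> eff_dom g" for z w
    unfolding assms(46) by (rule cSup_upper[OF _ bdd]) (use that in blast)
  have D2_diff: "\<bar>A z \<bullet> B (v - w)\<bar> \<le> 2 * D\<^sub>2"
    if "z \<in> eff_dom f" "v \<in> eff_dom g" "w \<in> eff_dom g" for z v w
    using D2[OF that(1,2)] D2[OF that(1,3)] by (simp add: B.diff inner_diff_right)
  have nonneg: "0 \<le> D\<^sub>f" "0 \<le> D\<^sub>g" "0 \<le> D\<^sub>2" "0 \<le> lam\<^sub>A" "0 \<le> lam\<^sub>B"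
    using Df[OF xs xs] Dg[OF ys ys] D2[OF xs ys] lambda_max_adjoint_self_nonneg assms(1,2,30,31)
    by auto
  have lamA: "(norm (A z))\<^sup>2 \<le> lam\<^sub>A * (norm z)\<^sup>2" for z
    unfolding assms(30) by (rule lambda_max_adjoint_self[OF assms(1)])
  have lamB: "(norm (B z))\<^sup>2 \<le> lam\<^sub>B * (norm z)\<^sup>2" for z
    unfolding assms(31) by (rule lambda_max_adjoint_self[OF assms(2)])

  \<comment> \<open>The two multiplier inclusions make the solution a minimizer of the Lagrangian:
    their inequalities are added, and feasibility of the solution merges the linear terms into a
    pairing with the residual.\<close>
  have saddle: "f1 x\<^sub>s + p2 x\<^sub>s + (g1 y\<^sub>s + q2 y\<^sub>s) \<le> f1 z + p2 z + (g1 w + q2 w) + lbar \<bullet> (A z + B w - c)"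
    if "z \<in> eff_dom f" "w \<in> eff_dom g" for z w
  proof -
    have "- adjoint A lbar \<in> subdifferential f x\<^sub>s" "- adjoint B lbar \<in> subdifferential g y\<^sub>s"
      using assms(28,29) by (auto simp: eq_neg_iff_add_eq_0[symmetric] add_eq_0_iff2)
    then have "f x\<^sub>s + ereal (- adjoint A lbar \<bullet> (z - x\<^sub>s)) \<le> f z"
      "g y\<^sub>s + ereal (- adjoint B lbar \<bullet> (w - y\<^sub>s)) \<le> g w"
      by (auto simp: subdifferential_def)
    then have "f1 x\<^sub>s + p2 x\<^sub>s - adjoint A lbar \<bullet> (z - x\<^sub>s) \<le> f1 z + p2 z"
      "g1 y\<^sub>s + q2 y\<^sub>s - adjoint B lbar \<bullet> (w - y\<^sub>s) \<le> g1 w + q2 w"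
      using that xs ys by (simp_all add: fval gval)
    moreover have "adjoint A lbar \<bullet> (z - x\<^sub>s) = lbar \<bullet> A (z - x\<^sub>s)"
      "adjoint B lbar \<bullet> (w - y\<^sub>s) = lbar \<bullet> B (w - y\<^sub>s)"
      using adjoint_works[OF assms(1)] adjoint_works[OF assms(2)] by (simp_all add: inner_commute)
    moreover have "A (z - x\<^sub>s) + B (w - y\<^sub>s) = A z + B w - c"
      by (simp add: A.diff B.diff flip: feas)
    then have "lbar \<bullet> A (z - x\<^sub>s) + lbar \<bullet> B (w - y\<^sub>s) = lbar \<bullet> (A z + B w - c)"
      by (metis inner_add_right)
    ultimately show ?thesis by linarith
  qed

  \<comment> \<open>Closed forms of the parameters and the one-step recursion\<close>
  have \<beta>: "\<beta> t = \<beta> 0 * (real t + 1) powr \<delta>" for t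
    by (cases t) (simp_all add: assms(45) add_ac)
  have \<beta>_pos: "0 < \<beta> t" for t by (subst \<beta>) (use assms(34) in auto)
  have \<beta>_pred: "\<beta> (t - 1) = \<beta> 0 * real t powr \<delta>" if "1 \<le> t" for t
    by (subst \<beta>) (use that in \<open>simp add: of_nat_diff\<close>)
  \<comment> \<open>This form fails at \<open>t = 0\<close>, where the power is 0 but
    \<open>H 0\<close> is positive; the recursion accordingly starts at
    \<open>t = 1\<close>.\<close>
  have H: "H t = H' * real t powr (1 - \<mu>)" if "1 \<le> t" for t
    using that assms(44)[of "t - 1"] by (simp add: assms(48) of_nat_diff)
  have H': "0 < H'" "2 * M\<^sub>f / (\<mu> + 1) \<le> H'" using assms(35) by (auto simp: assms(48))
  have H_nonneg: "0 \<le> H t" if "1 \<le> t" for t using H[OF that] H' by simp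
  have \<omega>0_nonneg: "0 \<le> \<omega>\<^sub>0" using H' by (simp add: assms(49))

  \<comment> \<open>Division by 8 turns the factor \<open>4 * H'\<close> of
    \<open>\<omega>\<^sub>0\<close> into \<open>H' / 2\<close>, giving the excess of
    \<open>prox_error_bound\<close>.\<close>
  define \<epsilon> where "\<epsilon> t = (if \<mu> < 1 then \<omega>\<^sub>0 / 8 * (real t powr (1 - \<mu>) / (real t)\<^sup>2) else 0)" for t :: nat
  define F where "F t = f1 (x t) + p2 (x t) + (g1 (y t) + q2 (y t))
    - (f1 x\<^sub>s + p2 x\<^sub>s + (g1 y\<^sub>s + q2 y\<^sub>s))" for t
  define P where "P t = F t + \<beta> (t - 1) / 2 * (norm (R t))\<^sup>2" for t
  define E where "E t = (H t + lam\<^sub>A * \<beta> t) / 2 * (\<alpha> t)\<^sup>2 * D\<^sub>f\<^sup>2 + \<epsilon> t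
    + (\<beta> t / 2 * (\<alpha> t)\<^sup>2 * lam\<^sub>B * D\<^sub>g\<^sup>2 + M\<^sub>g / (\<nu> + 1) * (\<alpha> t * D\<^sub>g) powr (\<nu> + 1))" for t
  \<comment> \<open>This arises because the y-update already uses the residual \<open>R' t\<close>
    instead of \<open>R t\<close>. It enters with only one factor \<open>\<alpha> t\<close> and is
    therefore kept apart from \<open>E\<close>.\<close>
  define C where "C t = \<beta> t * ((A (x (Suc t)) - A (x t)) \<bullet> B (y\<^sub>s - y t))" for t

  \<comment> \<open>\<open>P\<close> pairs iterate \<open>t\<close> with the previous penalty \<open>\<beta> (t - 1)\<close>: the descent step is taken with
    a fixed penalty, and the growth of \<open>\<beta>\<close> is absorbed by the surplus \<open>- \<alpha> \<beta> \<parallel>R\<parallel>\<^sup>2\<close>.\<close>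
  have step: "P (Suc t) \<le> real t / (real t + 2) * P t + 2 / (real t + 2) * C t + E t"
    if t: "1 \<le> t" for t
  proof -
    have R': "R t + A (x (Suc t) - x t) = R' t" by (simp add: assms(39,41) A.diff)
    have R: "R' t + B (y (Suc t) - y t) = R (Suc t)" by (simp add: assms(39,41) B.diff)
    have \<epsilon>: "\<epsilon> t = (if \<mu> < 1 then H' / 2 * (2 * M\<^sub>f / ((1 + \<mu>) * H')) powr (2 / (1 - \<mu>))
        * (real t powr (1 - \<mu>) / (real t)\<^sup>2) else 0)"
      by (simp add: \<epsilon>_def assms(49))
    have "M\<^sub>f / (\<mu> + 1) * norm (x (Suc t) - x t) powr (\<mu> + 1)
        \<le> H t / 2 * (norm (x (Suc t) - x t))\<^sup>2 + \<epsilon> t"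
      unfolding H[OF t] \<epsilon> by (rule prox_error_bound[OF assms(18,19,22) H']) (use t in auto)
    then have descent: "f1 (x (Suc t)) \<le> f1 (x t) + grad_f1 (x t) \<bullet> (x (Suc t) - x t)
        + H t / 2 * (norm (x (Suc t) - x t))\<^sup>2 + \<epsilon> t"
      using assms(24)[OF xd xd, of "Suc t" t] by linarith
    have "f1 (x (Suc t)) + p2 (x (Suc t)) + \<beta> t / 2 * (norm (R' t))\<^sup>2
      \<le> (1 - \<alpha> t) * (f1 (x t) + p2 (x t)) + \<alpha> t * (f1 x\<^sub>s + p2 x\<^sub>s) + \<beta> t / 2 * (norm (R t))\<^sup>2
        + \<alpha> t * \<beta> t * (R t \<bullet> A (x\<^sub>s - x t))
        + (H t + lam\<^sub>A * \<beta> t) / 2 * (\<alpha> t)\<^sup>2 * (norm (x\<^sub>s - x t))\<^sup>2 + \<epsilon> t"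
      unfolding R'[symmetric]
      by (rule prox_step[OF assms(1) cvxf xd xs \<alpha>(2,3) less_imp_le[OF \<beta>_pos]
            smooth_convex_above_tangent[OF assms(12)] descent lamA])
         (use x_opt(2) in \<open>simp add: p2_def\<close>)
    also have "(H t + lam\<^sub>A * \<beta> t) / 2 * (\<alpha> t)\<^sup>2 * (norm (x\<^sub>s - x t))\<^sup>2
        \<le> (H t + lam\<^sub>A * \<beta> t) / 2 * (\<alpha> t)\<^sup>2 * D\<^sub>f\<^sup>2"
      using H_nonneg[OF t] nonneg \<beta>_pos[of t] Df[OF xs xd]
      by (intro mult_left_mono power_mono) auto
    finally have X: "f1 (x (Suc t)) + p2 (x (Suc t)) + \<beta> t / 2 * (norm (R' t))\<^sup>2
      \<le> (1 - \<alpha> t) * (f1 (x t) + p2 (x t)) + \<alpha> t * (f1 x\<^sub>s + p2 x\<^sub>s) + \<beta> t / 2 * (norm (R t))\<^sup>2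
        + \<alpha> t * \<beta> t * (R t \<bullet> A (x\<^sub>s - x t))
        + (H t + lam\<^sub>A * \<beta> t) / 2 * (\<alpha> t)\<^sup>2 * D\<^sub>f\<^sup>2 + \<epsilon> t"
      by simp
    have "norm (y (Suc t) - y t) = \<alpha> t * norm (u t - y t)"
      using \<alpha>(2)[of t] by (simp add: assms(43))
    then have "norm (y (Suc t) - y t) \<le> \<alpha> t * D\<^sub>g"
      using Dg[OF ud yd] \<alpha>(2) by (simp add: mult_left_mono)
    then have "M\<^sub>g / (\<nu> + 1) * norm (y (Suc t) - y t) powr (\<nu> + 1)
        \<le> M\<^sub>g / (\<nu> + 1) * (\<alpha> t * D\<^sub>g) powr (\<nu> + 1)"
      using assms(20,23) by (intro mult_left_mono powr_mono2) auto
    then have descent: "g1 (y (Suc t)) \<le> g1 (y t) + grad_g1 (y t) \<bullet> (y (Suc t) - y t)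
        + M\<^sub>g / (\<nu> + 1) * (\<alpha> t * D\<^sub>g) powr (\<nu> + 1)"
      using assms(25)[OF yd yd, of "Suc t" t] by linarith
    have "g1 (y (Suc t)) + q2 (y (Suc t)) + \<beta> t / 2 * (norm (R (Suc t)))\<^sup>2
      \<le> (1 - \<alpha> t) * (g1 (y t) + q2 (y t)) + \<alpha> t * (g1 y\<^sub>s + q2 y\<^sub>s) + \<beta> t / 2 * (norm (R' t))\<^sup>2
        + \<alpha> t * \<beta> t * (R' t \<bullet> B (y\<^sub>s - y t))
        + \<beta> t / 2 * (\<alpha> t)\<^sup>2 * lam\<^sub>B * (norm (u t - y t))\<^sup>2
        + M\<^sub>g / (\<nu> + 1) * (\<alpha> t * D\<^sub>g) powr (\<nu> + 1)"
      unfolding R[symmetric]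
      by (rule conditional_gradient_step[OF assms(2) cvxg yd ud ys \<alpha>(2,3) less_imp_le[OF \<beta>_pos]
            assms(43) smooth_convex_above_tangent[OF assms(13)] descent lamB])
         (use u_opt(2) in \<open>simp add: q2_def\<close>)
    also have "\<beta> t / 2 * (\<alpha> t)\<^sup>2 * lam\<^sub>B * (norm (u t - y t))\<^sup>2 \<le> \<beta> t / 2 * (\<alpha> t)\<^sup>2 * lam\<^sub>B * D\<^sub>g\<^sup>2"
      using nonneg \<beta>_pos[of t] Dg[OF ud yd] by (intro mult_left_mono power_mono) auto
    finally have Y: "g1 (y (Suc t)) + q2 (y (Suc t)) + \<beta> t / 2 * (norm (R (Suc t)))\<^sup>2
      \<le> (1 - \<alpha> t) * (g1 (y t) + q2 (y t)) + \<alpha> t * (g1 y\<^sub>s + q2 y\<^sub>s) + \<beta> t / 2 * (norm (R' t))\<^sup>2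
        + \<alpha> t * \<beta> t * (R' t \<bullet> B (y\<^sub>s - y t)) + \<beta> t / 2 * (\<alpha> t)\<^sup>2 * lam\<^sub>B * D\<^sub>g\<^sup>2
        + M\<^sub>g / (\<nu> + 1) * (\<alpha> t * D\<^sub>g) powr (\<nu> + 1)"
      by simp
    \<comment> \<open>Moving both blocks towards the feasible solution points against the residual;
      this is the source of the surplus, and exchanging \<open>R t\<close> for \<open>R' t\<close>
      leaves exactly \<open>C t\<close>.\<close>
    have "A (x\<^sub>s - x t) + B (y\<^sub>s - y t) = - R t"
      by (simp add: assms(39) A.diff B.diff flip: feas)
    then have "R t \<bullet> A (x\<^sub>s - x t) + R t \<bullet> B (y\<^sub>s - y t) = - (norm (R t))\<^sup>2"
      by (metis inner_add_right inner_minus_right power2_norm_eq_inner)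
    moreover have "R' t \<bullet> B (y\<^sub>s - y t)
        = R t \<bullet> B (y\<^sub>s - y t) + (A (x (Suc t)) - A (x t)) \<bullet> B (y\<^sub>s - y t)"
      by (simp add: inner_add_left A.diff flip: R')
    ultimately have "R t \<bullet> A (x\<^sub>s - x t) + R' t \<bullet> B (y\<^sub>s - y t)
        = (A (x (Suc t)) - A (x t)) \<bullet> B (y\<^sub>s - y t) - (norm (R t))\<^sup>2" by linarith
    then have cross: "\<alpha> t * \<beta> t * (R t \<bullet> A (x\<^sub>s - x t)) + \<alpha> t * \<beta> t * (R' t \<bullet> B (y\<^sub>s - y t))
        = \<alpha> t * C t - \<alpha> t * \<beta> t * (norm (R t))\<^sup>2"
      unfolding C_def by (metis (no_types) distrib_left mult.assoc right_diff_distrib)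
    \<comment> \<open>Adding the two block inequalities leaves
      \<open>(1 - 2 * \<alpha> t) * \<beta> t / 2\<close> as the coefficient of the squared
      residual, while \<open>P t\<close> offers
      \<open>(1 - \<alpha> t) * \<beta> (t - 1) / 2\<close>.\<close>
    have "(1 - 2 * \<alpha> t) * \<beta> t \<le> (1 - \<alpha> t) * \<beta> (t - 1)"
      using mult_left_mono[OF penalty_weight[of "real t" \<delta>], of "\<beta> 0"] t assms(34,36,37)
      by (subst \<beta>, subst \<beta>_pred[OF t]) (simp add: \<alpha>(1) mult_ac)
    then have "(1 - 2 * \<alpha> t) * \<beta> t * ((norm (R t))\<^sup>2 / 2) \<le> (1 - \<alpha> t) * \<beta> (t - 1) * ((norm (R t))\<^sup>2 / 2)"
      by (rule mult_right_mono) simp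
    then have "P (Suc t) \<le> (1 - \<alpha> t) * P t + \<alpha> t * C t + E t"
      using X Y cross unfolding P_def F_def E_def
      by (simp add: algebra_simps add_divide_distrib diff_divide_distrib)
    moreover have "1 - \<alpha> t = real t / (real t + 2)" by (simp add: \<alpha>(1) field_simps)
    ultimately show ?thesis by (simp add: \<alpha>(1))
  qed

  \<comment> \<open>Weighted errors\<close>
  \<comment> \<open>\<open>C2\<close> is \<open>\<omega>\<^sub>2\<close> without its
    \<open>D\<^sub>2\<close> part, and \<open>C4\<close> is \<open>\<omega>\<^sub>4\<close> or
    \<open>\<omega>\<^sub>5\<close> according to \<mu>, so both cases share one argument.\<close>
  define C2 C4 where "C2 = 2 * lam\<^sub>A * D\<^sub>f\<^sup>2 * \<beta> 0 + 2 * lam\<^sub>B * D\<^sub>g\<^sup>2 * \<beta> 0"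
    and "C4 = 2 * H' * D\<^sub>f\<^sup>2 + (if \<mu> < 1 then 2 * \<omega>\<^sub>0 else 0)"
  have \<omega>3_nonneg: "0 \<le> \<omega>\<^sub>3" using assms(20,23) by (simp add: assms(52))
  \<comment> \<open>The bound is uniform in \<open>s < m\<close>, so the sum costs only a factor
    \<open>m\<close>; \<open>real m powr \<delta>\<close> is enough because
    \<open>s + 1 \<le> m\<close>.\<close>
  have error: "(real s + 1) * (real s + 2) * E s
      \<le> C2 * real m powr \<delta> + \<omega>\<^sub>3 * (real m + 1) powr (1 - \<nu>) + C4 * (real m + 1) powr (1 - \<mu>)"
    if s: "1 \<le> s" "s < m" for s m
  proof -
    define W where "W = (real s + 1) * (real s + 2)"
    have sq: "W * (K * (\<alpha> s)\<^sup>2) \<le> 4 * K" if "0 \<le> K" for K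
      using stepsize_square_weight[of "real s" K] that by (simp add: W_def \<alpha>(1))
    have s\<delta>: "(real s + 1) powr \<delta> \<le> real m powr \<delta>" using s assms(36) by (intro powr_mono2) auto
    have s\<mu>: "real s powr (1 - \<mu>) \<le> (real m + 1) powr (1 - \<mu>)"
      using s assms(19) by (intro powr_mono2) auto
    have "W * (H s / 2 * D\<^sub>f\<^sup>2 * (\<alpha> s)\<^sup>2) \<le> 2 * H' * D\<^sub>f\<^sup>2 * real s powr (1 - \<mu>)"
      using sq[of "H s / 2 * D\<^sub>f\<^sup>2"] H' by (simp add: H[OF s(1)] mult_ac)
    also have "\<dots> \<le> 2 * H' * D\<^sub>f\<^sup>2 * (real m + 1) powr (1 - \<mu>)"
      using s\<mu> H' by (intro mult_left_mono) auto
    finally have e1: "W * (H s / 2 * D\<^sub>f\<^sup>2 * (\<alpha> s)\<^sup>2) \<le> 2 * H' * D\<^sub>f\<^sup>2 * (real m + 1) powr (1 - \<mu>)" .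
    have e2: "W * (\<beta> s * K * (\<alpha> s)\<^sup>2) \<le> 4 * \<beta> 0 * K * real m powr \<delta>" if "0 \<le> K" for K
    proof -
      have "W * (\<beta> s * K * (\<alpha> s)\<^sup>2) \<le> 4 * (\<beta> s * K)"
        using that less_imp_le[OF \<beta>_pos] by (intro sq) auto
      also have "\<dots> = 4 * \<beta> 0 * K * (real s + 1) powr \<delta>" by (subst \<beta>) simp
      also have "\<dots> \<le> 4 * \<beta> 0 * K * real m powr \<delta>"
        using that assms(34) s\<delta> by (intro mult_left_mono) auto
      finally show ?thesis .
    qed
    have "W * (M\<^sub>g / (\<nu> + 1) * (\<alpha> s * D\<^sub>g) powr (\<nu> + 1))
        = M\<^sub>g / (\<nu> + 1) * D\<^sub>g powr (\<nu> + 1) * (W * \<alpha> s powr (\<nu> + 1))"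
      using \<alpha>(2)[of s] nonneg by (simp add: powr_mult mult_ac)
    also have "\<dots> \<le> M\<^sub>g / (\<nu> + 1) * D\<^sub>g powr (\<nu> + 1) * (2 powr (\<nu> + 1) * (real s + 2) powr (1 - \<nu>))"
      using stepsize_powr_weight[of "real s" \<nu>] assms(20,23)
      by (intro mult_left_mono) (auto simp: W_def \<alpha>(1))
    also have "\<dots> = \<omega>\<^sub>3 * (real s + 2) powr (1 - \<nu>)" by (simp add: assms(52))
    also have "\<dots> \<le> \<omega>\<^sub>3 * (real m + 1) powr (1 - \<nu>)"
      using \<omega>3_nonneg s assms(21) by (intro mult_left_mono powr_mono2) auto
    finally have e3: "W * (M\<^sub>g / (\<nu> + 1) * (\<alpha> s * D\<^sub>g) powr (\<nu> + 1)) \<le> \<omega>\<^sub>3 * (real m + 1) powr (1 - \<nu>)" .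
    have e4: "W * \<epsilon> s \<le> (if \<mu> < 1 then 2 * \<omega>\<^sub>0 else 0) * (real m + 1) powr (1 - \<mu>)"
    proof (cases "\<mu> < 1")
      case True
      \<comment> \<open>For \<open>s \<ge> 1\<close> the weight is at most
        \<open>6 * (real s)\<^sup>2\<close>, which cancels the denominator of
        \<open>\<epsilon> s\<close>; the resulting factor 6/8 lies below 2.\<close>
      have "1 * 1 \<le> real s * real s" "1 * real s \<le> real s * real s"
        using s by (intro mult_mono; simp)+
      then have "W \<le> 6 * (real s)\<^sup>2" by (simp add: W_def power2_eq_square algebra_simps)
      then have "W * \<epsilon> s \<le> 6 * (real s)\<^sup>2 * \<epsilon> s"
        using \<omega>0_nonneg by (intro mult_right_mono) (auto simp: \<epsilon>_def)
      also have "\<dots> = 6 / 8 * \<omega>\<^sub>0 * real s powr (1 - \<mu>)"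
        using s True by (simp add: \<epsilon>_def)
      also have "\<dots> \<le> 2 * \<omega>\<^sub>0 * (real m + 1) powr (1 - \<mu>)"
        using \<omega>0_nonneg s\<mu> by (intro mult_mono) auto
      finally show ?thesis using True by simp
    qed (simp add: \<epsilon>_def)
    have "W * E s = W * (H s / 2 * D\<^sub>f\<^sup>2 * (\<alpha> s)\<^sup>2) + W * (\<beta> s * (lam\<^sub>A * D\<^sub>f\<^sup>2 / 2) * (\<alpha> s)\<^sup>2)
        + W * \<epsilon> s + W * (\<beta> s * (lam\<^sub>B * D\<^sub>g\<^sup>2 / 2) * (\<alpha> s)\<^sup>2)
        + W * (M\<^sub>g / (\<nu> + 1) * (\<alpha> s * D\<^sub>g) powr (\<nu> + 1))"
      unfolding E_def by (simp add: distrib_left distrib_right add_divide_distrib mult_ac)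
    also have "\<dots> \<le> 2 * H' * D\<^sub>f\<^sup>2 * (real m + 1) powr (1 - \<mu>)
        + 4 * \<beta> 0 * (lam\<^sub>A * D\<^sub>f\<^sup>2 / 2) * real m powr \<delta>
        + (if \<mu> < 1 then 2 * \<omega>\<^sub>0 else 0) * (real m + 1) powr (1 - \<mu>)
        + 4 * \<beta> 0 * (lam\<^sub>B * D\<^sub>g\<^sup>2 / 2) * real m powr \<delta> + \<omega>\<^sub>3 * (real m + 1) powr (1 - \<nu>)"
      using nonneg by (intro add_mono e1 e2 e3 e4) auto
    also have "\<dots> = C2 * real m powr \<delta> + \<omega>\<^sub>3 * (real m + 1) powr (1 - \<nu>) + C4 * (real m + 1) powr (1 - \<mu>)"
      unfolding C2_def C4_def by (simp add: algebra_simps)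
    finally show ?thesis unfolding W_def .
  qed

  \<comment> \<open>The rate of the penalized gap\<close>
  have rate: "P m \<le> \<tau> m" if m: "1 \<le> m" for m
  proof -
    let ?X = "C2 * real m powr \<delta> + \<omega>\<^sub>3 * (real m + 1) powr (1 - \<nu>) + C4 * (real m + 1) powr (1 - \<mu>)"
    have C_nonneg: "0 \<le> C2" "0 \<le> C4"
      using nonneg assms(34) H' \<omega>0_nonneg by (auto simp: C2_def C4_def)
    have card: "real (card {1..<m}) \<le> real m" by simp
    have "(\<Sum>s\<in>{1..<m}. (real s + 1) * (real s + 2) * E s) \<le> real (card {1..<m}) * ?X"
      by (intro sum_bounded_above error) auto
    also have "\<dots> \<le> real m * ?X"
      using card C_nonneg \<omega>3_nonneg by (intro mult_right_mono) auto
    finally have errors: "(\<Sum>s\<in>{1..<m}. (real s + 1) * (real s + 2) * E s) \<le> real m * ?X" .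

    \<comment> \<open>Summation by parts with \<open>a s = A (x s)\<close> and
      \<open>b s = B (y\<^sub>s - y s)\<close>. The bound \<open>K = 2 * D\<^sub>2\<close> has its
      factor 2 from the difference inside \<open>B\<close>.\<close>
    have cross: "(\<Sum>s\<in>{1..<m}. 2 * (real s + 1) * \<beta> s * ((A (x (Suc s)) - A (x s)) \<bullet> B (y\<^sub>s - y s)))
        \<le> 2 * (2 * D\<^sub>2) * (2 * (real m + 1) * \<beta> m) + (\<Sum>s\<in>{1..<m}. 8 * D\<^sub>2 * \<beta> s)"
    proof (rule summation_by_parts_bound[OF _ _ _ _ m])
      fix s :: nat
      show "0 \<le> 2 * (real s + 1) * \<beta> s" using \<beta>_pos[of s] by simp
      have "\<beta> s \<le> \<beta> (Suc s)"
        by (subst (1 2) \<beta>) (use assms(34,36) in \<open>auto intro!: mult_left_mono powr_mono2\<close>)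
      then show "2 * (real s + 1) * \<beta> s \<le> 2 * (real (Suc s) + 1) * \<beta> (Suc s)"
        using \<beta>_pos[of s] by (intro mult_mono) auto
      show "\<bar>A (x s) \<bullet> B (y\<^sub>s - y s)\<bar> \<le> 2 * D\<^sub>2" by (intro D2_diff xd ys yd)
      \<comment> \<open>The increment of \<open>b\<close> carries a factor
        \<open>\<alpha> s\<close>, which cancels the growth \<open>s + 1\<close> of the
        weight.\<close>
      have "B (y\<^sub>s - y (Suc s)) - B (y\<^sub>s - y s) = - (\<alpha> s *\<^sub>R B (u s - y s))"
        by (simp add: assms(43) B.diff B.add B.scaleR)
      then have "\<bar>A (x (Suc s)) \<bullet> (B (y\<^sub>s - y (Suc s)) - B (y\<^sub>s - y s))\<bar>
          = \<alpha> s * \<bar>A (x (Suc s)) \<bullet> B (u s - y s)\<bar>"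
        using \<alpha>(2)[of s] by (simp add: abs_mult)
      also have "\<dots> \<le> \<alpha> s * (2 * D\<^sub>2)"
        using \<alpha>(2) by (intro mult_left_mono D2_diff xd ud yd) auto
      finally have "2 * (real s + 1) * \<beta> s
          * \<bar>A (x (Suc s)) \<bullet> (B (y\<^sub>s - y (Suc s)) - B (y\<^sub>s - y s))\<bar>
          \<le> 2 * (real s + 1) * \<beta> s * (\<alpha> s * (2 * D\<^sub>2))"
        using \<beta>_pos[of s] by (intro mult_left_mono) auto
      also have "\<dots> = (8 * D\<^sub>2 * \<beta> s) * ((real s + 1) / (real s + 2))" by (simp add: \<alpha>(1))
      also have "\<dots> \<le> (8 * D\<^sub>2 * \<beta> s) * 1"
        using \<beta>_pos[of s] nonneg by (intro mult_left_mono) auto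
      finally show "2 * (real s + 1) * \<beta> s
          * \<bar>A (x (Suc s)) \<bullet> (B (y\<^sub>s - y (Suc s)) - B (y\<^sub>s - y s))\<bar> \<le> 8 * D\<^sub>2 * \<beta> s" by simp
    qed
    have "(\<Sum>s\<in>{1..<m}. 8 * D\<^sub>2 * \<beta> s) \<le> real (card {1..<m}) * (8 * D\<^sub>2 * (\<beta> 0 * real m powr \<delta>))"
    proof (intro sum_bounded_above mult_left_mono)
      fix s assume "s \<in> {1..<m}"
      then show "\<beta> s \<le> \<beta> 0 * real m powr \<delta>"
        by (subst \<beta>) (use assms(34,36) in \<open>auto intro!: mult_left_mono powr_mono2\<close>)
    qed (use nonneg in simp)
    also have "\<dots> \<le> real m * (8 * D\<^sub>2 * (\<beta> 0 * real m powr \<delta>))"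
      using card nonneg assms(34) by (intro mult_right_mono) auto
    finally have "(\<Sum>s\<in>{1..<m}. 8 * D\<^sub>2 * \<beta> s) \<le> 8 * (D\<^sub>2 * \<beta> 0) * real m powr (1 + \<delta>)"
      using m by (simp add: powr_add mult_ac)
    moreover have "2 * (2 * D\<^sub>2) * (2 * (real m + 1) * \<beta> m) = 8 * (D\<^sub>2 * \<beta> 0) * (real m + 1) powr (1 + \<delta>)"
      by (subst \<beta>) (simp add: powr_add)
    ultimately have "(\<Sum>s\<in>{1..<m}. 2 * (real s + 1) * C s)
        \<le> 8 * (D\<^sub>2 * \<beta> 0) * ((real m + 1) powr (1 + \<delta>) + real m powr (1 + \<delta>))"
      using cross unfolding C_def distrib_left mult.assoc by linarith
    \<comment> \<open>\<open>P 1\<close> contains the penalty \<open>\<beta> (1 - 1)\<close>, which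
      is the \<open>\<beta> 0\<close> in the definition of \<theta>.\<close>
    moreover have "2 * P 1 = \<theta>"
      by (simp add: P_def F_def assms(47) fval gval xd yd xs ys assms(39))
    ultimately have "real m * (real m + 1) * P m \<le> \<theta>
        + 8 * (D\<^sub>2 * \<beta> 0) * ((real m + 1) powr (1 + \<delta>) + real m powr (1 + \<delta>)) + real m * ?X"
      using weighted_recursion[OF step m] errors by simp
    \<comment> \<open>\<open>rate_bound\<close> applies with
      \<open>K = D\<^sub>2 * \<beta> 0\<close> and \<open>C1 = \<omega>\<^sub>1\<close>, which
      exceeds \<theta> by a nonnegative multiple of \<open>D\<^sub>2\<close>.\<close>
    then have "P m \<le> \<omega>\<^sub>1 / (real m * (real m + 1))
        + (C2 + (32 + 16 * \<delta>) / (1 + \<delta>) * (D\<^sub>2 * \<beta> 0)) / (real m + 1) powr (1 - \<delta>)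
        + \<omega>\<^sub>3 / (real m + 1) powr \<nu> + C4 / (real m + 1) powr \<mu>"
      using m nonneg assms(34,36,37) C_nonneg \<omega>3_nonneg
      by (intro rate_bound) (auto simp: assms(50))
    also have "\<dots> = \<tau> m"
      using assms(19) by (auto simp: assms(51,53,54,55) C2_def C4_def not_less mult.assoc)
    finally show ?thesis .
  qed

  \<comment> \<open>Separating the objective gap from the residual\<close>
  have "\<bar>f (x t) + g (y t) - f x\<^sub>s - g y\<^sub>s\<bar> \<le> ereal (max (\<tau> t) (norm lbar * G t)) \<and>
      norm (A (x t) + B (y t) - c) \<le> G t" if "2 \<le> t" for t
  proof -
    \<comment> \<open>The penalty paired with iterate \<open>t\<close> is
      \<open>\<beta> (t - 1)\<close>, which explains \<open>real t powr \<delta>\<close> in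
      \<open>G t\<close>.\<close>
    define b where "b = \<beta> (t - 1)"
    have b: "0 < b" "b = \<beta> 0 * real t powr \<delta>" using \<beta>_pos \<beta>_pred that by (auto simp: b_def)
    have P: "F t + b / 2 * (norm (R t))\<^sup>2 \<le> \<tau> t"
      using rate[of t] that by (simp add: P_def b_def)
    \<comment> \<open>The Lagrangian bound with Cauchy-Schwarz limits how negative the gap can be.
      Inserted into the bound on \<open>P\<close>, it leaves a quadratic inequality in
      \<open>norm (R t)\<close> alone.\<close>
    have lower: "- F t \<le> norm lbar * norm (R t)"
      using saddle[OF xd yd, of t t] norm_cauchy_schwarz[of lbar "R t"]
      by (simp add: F_def assms(39))
    then have "norm (R t) \<le> norm lbar / b + sqrt ((norm lbar)\<^sup>2 / b\<^sup>2 + 2 * \<tau> t / b)"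
      using P by (intro quadratic_root_bound b) simp
    also have "\<dots> = G t"
      using that by (simp add: assms(56) b power_mult_distrib powr_powr mult.commute
          flip: powr_realpow)
    finally have RG: "norm (R t) \<le> G t" .
    then have "norm lbar * norm (R t) \<le> norm lbar * G t" by (intro mult_left_mono) auto
    moreover have "0 \<le> b / 2 * (norm (R t))\<^sup>2" using b by simp
    then have "F t \<le> \<tau> t" using P by linarith
    ultimately have "\<bar>F t\<bar> \<le> max (\<tau> t) (norm lbar * G t)" using lower by linarith
    moreover have "f (x t) + g (y t) - f x\<^sub>s - g y\<^sub>s = ereal (F t)"
      by (simp add: fval gval xd yd xs ys F_def)
    ultimately show ?thesis
      using RG unfolding assms(39) by (simp only: abs_ereal.simps ereal_less_eq simp_thms)
  qed
  with bdd show ?thesis by blast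
qed

end
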